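(* Let $\varphi:(\mathbb{R}^n)^\kappa\to\mathbb{R}^1$ be a continuous proper convex function, $F(\cdot,t):(\mathbb{R}^n)^\kappa\rightrightarrows\mathbb{R}^n$ ($t\in[0,1]$) a convex set-valued mapping, and $Q_j\subseteq\mathbb{R}^n$, $j=0,\dots,\kappa-1$, convex sets. Consider the primary problem $(P_H)$: minimize $\varphi\big(x(1),x'(1),\dots,x^{(\kappa-1)}(1)\big)$ over feasible trajectories, i.e. subject to $$x^{(\kappa)}(t)\in F\big(x(t),x'(t),\dots,x^{(\kappa-1)}(t),t\big)\ \text{a.e. }t\in[0,1],\qquad x^{(j)}(0)\in Q_j,\ j=0,\dots,\kappa-1,$$ and the dual problem $(P_H^* )$: maximize over families of functions $\{x^*(\cdot),\eta_j^*(\cdot),j=1,\dots,\kappa-1\}$ $$-\varphi^*\Big((-1)^\kappa x^{*(\kappa-1)}(1)+\eta_{\kappa-1}^*(1),\,(-1)^{\kappa-1}x^{*(\kappa-2)}(1)+\eta_{\kappa-2}^*(1),\dots,x^{*\prime}(1)+\eta_1^*(1),\,-x^*(1)\Big)$$ $$+\int_0^1 M_{F(\cdot,t)}\Big((-1)^\kappa x^{*(\kappa)}(t)+\eta_{\kappa-1}^{*\prime}(t),\,\eta_{\kappa-1}^*(t)+\eta_{\kappa-2}^{*\prime}(t),\dots,\eta_2^*(t)+\eta_1^{*\prime}(t),\,\eta_1^*(t),\,x^*(t)\Big)dt$$ $$-\sum_{j=1}^{\kappa-1}W_{Q_{\kappa-j-1}}\Big((-1)^jx^{*(j)}(0)-\eta_j^*(0)\Big)-W_{Q_{\kappa-1}}\big(x^*(0)\big).$$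 Let $\tilde x(\cdot)$ be an optimal solution of $(P_H)$ for which the sufficient optimality conditions hold, i.e. there exists a family $\{x^*,\eta_j^*\}$ satisfying (i)–(iv) below. Then a family $\{\tilde x^*(t),\tilde\eta_j^*(t),j=1,\dots,\kappa-1\}$, $t\in[0,1]$, is an optimal solution of $(P_H^* )$ if and only if it satisfies conditions (i)–(iii) below (with $x^*=\tilde x^*$, $\eta_j^*=\tilde\eta_j^*$). In addition, the optimal values of $(P_H)$ and $(P_H^* )$ are equal. (i) for a.e. $t\in[0,1]$, $\Big((-1)^\kappa x^{*(\kappa)}(t)+\eta_{\kappa-1}^{*\prime}(t),\ \eta_{\kappa-1}^*(t)+\eta_{\kappa-2}^{*\prime}(t),\dots,\eta_2^*(t)+\eta_1^{*\prime}(t),\ \eta_1^*(t)\Big)\in F^*\big(x^*(t);(\tilde x(t),\tilde x'(t),\dots,\tilde x^{(\kappa)}(t)),t\big)$; (ii) $(-1)^{j+1}x^{*(j)}(0)+\eta_j^*(0)\in K^*_{Q_{\kappa-j-1}}\big(\tilde x^{(\kappa-j-1)}(0)\big)$ for $j=1,\dots,\kappa-1$, and $-x^*(0)\in K^*_{Q_{\kappa-1}}\big(\tilde x^{(\kappa-1)}(0)\big)$; (iii) $\Big((-1)^\kappa x^{*(\kappa-1)}(1)+\eta_{\kappa-1}^*(1),\ (-1)^{\kappa-1}x^{*(\kappa-2)}(1)+\eta_{\kappa-2}^*(1),\dots,x^{*\prime}(1)+\eta_1^*(1),\ -x^*(1)\Big)\in\partial\varphi\big(\tilde x(1),\tilde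 x'(1),\dots,\tilde x^{(\kappa-1)}(1)\big)$; (iv) $\tilde x^{(\kappa)}(t)\in F_A\big(\tilde x(t),\dots,\tilde x^{(\kappa-1)}(t);x^*(t),t\big)$ for a.e. $t\in[0,1]$.
   Context: $\kappa\ge1$ is a fixed natural number. A feasible trajectory is an $x:[0,1]\to\mathbb{R}^n$ absolutely continuous together with its derivatives up to order $\kappa-1$, with $x^{(\kappa)}\in L_1^n([0,1])$, satisfying the inclusion a.e. and the initial constraints. In all families, $x^*:[0,1]\to\mathbb{R}^n$ is absolutely continuous together with its derivatives up to order $\kappa-1$, with $x^{*(\kappa)}\in L_1^n([0,1])$, and each $\eta_j^*:[0,1]\to\mathbb{R}^n$ is absolutely continuous with $\eta_j^{*\prime}\in L_1^n([0,1])$. Convention: $\eta_0^*\equiv0$ (for $\kappa=1$ the tuples reduce to $-x^{*\prime}(t)$ in (i), $-x^*(1)$ in (iii) and in $\varphi^*$, and $(-x^{*\prime}(t),x^*(t))$ in $M_{F(\cdot,t)}$). A set-valued mapping $F:(\mathbb{R}^n)^\kappa\rightrightarrows\mathbb{R}^n$ is convex if $\operatorname{gph}F=\{(x,v_1,\dots,v_{\kappa-1},v):v\in F(x,v_1,\dots,v_{\kappa-1})\}$ is convex. For a convex set $A$ and $z\in A$, $K_A(z)=\operatorname{cone}(A-z)=\{\lambda(z_1-z):z_1\in A,\lambda>0\}$ and $K_A^*(z)=\{z^*:\langle\bar z,z^*\rangle\ge0\ \forall\bar z\in K_A(z)\}$. The locally adjoint mapping of convex $F$ at $z\in\operatorname{gph}F$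 is $F^*(v^*;z)=\{(x^*,v_1^*,\dots,v_{\kappa-1}^* ):(x^*,v_1^*,\dots,v_{\kappa-1}^*,-v^* )\in K^*_{\operatorname{gph}F}(z)\}$; $F^*(\cdot;\cdot,t)$ is that of $F(\cdot,t)$. The argmaximum set is $F_A(x,v_1,\dots,v_{\kappa-1};v^* )=\{v\in F(x,v_1,\dots,v_{\kappa-1}):\langle v,v^*\rangle=\sup_{w\in F(x,v_1,\dots,v_{\kappa-1})}\langle w,v^*\rangle\}$; $F_A(\cdot;\cdot,t)$ is that of $F(\cdot,t)$. Moreover $$M_F(x^*,v_1^*,\dots,v_{\kappa-1}^*,v^* )=\inf\{\langle x,x^*\rangle+\langle v_1,v_1^*\rangle+\dots+\langle v_{\kappa-1},v_{\kappa-1}^*\rangle-\langle v,v^*\rangle:(x,v_1,\dots,v_{\kappa-1},v)\in\operatorname{gph}F\},$$ $W_Q(y^* )=\sup_{y\in Q}\langle y,y^*\rangle$ is the support function, $\varphi^*$ is the convex conjugate of $\varphi$, and $\partial\varphi$ its convex subdifferential. *)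

theory Defs
  imports "HOL-Analysis.Analysis"
begin

text \<open>
  Conventions. The space of \<open>\<kappa>\<close>-tuples of vectors in \<open>n\<close>-dimensional space is \<open>(real^'n)^'k\<close>, where
  \<open>'k\<close> is a finite linearly ordered index type and \<open>\<kappa> = CARD('k)\<close>; as types are nonempty,
  \<open>\<kappa> \<ge> 1\<close> and \<open>n \<ge> 1\<close>. Tuples are numbered \<open>0, \<dots>, \<kappa>-1\<close> in increasing order of the index.
\<close>

definition pos :: "'k::{finite,linorder} \<Rightarrow> nat" where
  "pos i = card {j. j < i}"

definition tuple :: "(nat \<Rightarrow> 'a) \<Rightarrow> 'a^'k::{finite,linorder}" where
  "tuple f = (\<chi> i. f (pos i))"


section \<open>Convex analysis\<close>

definition gph :: "('a \<Rightarrow> 'b set) \<Rightarrow> ('a \<times> 'b) set" where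
  "gph F = {(z, v). v \<in> F z}"

definition convex_map :: "('a::real_vector \<Rightarrow> 'b::real_vector set) \<Rightarrow> bool" where
  "convex_map F \<longleftrightarrow> convex (gph F)"

definition tangent_cone :: "'a::real_vector set \<Rightarrow> 'a \<Rightarrow> 'a set" where
  "tangent_cone A z = {c *\<^sub>R (z1 - z) | c z1. z1 \<in> A \<and> c > 0}"

definition dual_cone :: "'a::real_inner set \<Rightarrow> 'a \<Rightarrow> 'a set" where
  "dual_cone A z = {zs. \<forall>y\<in>tangent_cone A z. y \<bullet> zs \<ge> 0}"

text \<open>Locally adjoint mapping, meant for \<open>z \<in> gph F\<close>.\<close>

definition lam :: "('a::real_inner \<Rightarrow> 'b::real_inner set) \<Rightarrow> 'b \<Rightarrow> 'a \<times> 'b \<Rightarrow> 'a set" where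
  "lam F vs z = {zs. (zs, - vs) \<in> dual_cone (gph F) z}"

definition argmax_set :: "('a \<Rightarrow> 'b::real_inner set) \<Rightarrow> 'a \<Rightarrow> 'b \<Rightarrow> 'b set" where
  "argmax_set F z vs = {v \<in> F z. ereal (v \<bullet> vs) = (SUP w\<in>F z. ereal (w \<bullet> vs))}"

definition M_fun :: "('a::real_inner \<Rightarrow> 'b::real_inner set) \<Rightarrow> 'a \<Rightarrow> 'b \<Rightarrow> ereal" where
  "M_fun F zs vs = (INF (z, v)\<in>gph F. ereal (z \<bullet> zs - v \<bullet> vs))"

definition supp_fun :: "'a::real_inner set \<Rightarrow> 'a \<Rightarrow> ereal" where
  "supp_fun Q ys = (SUP y\<in>Q. ereal (y \<bullet> ys))"

definition conjugate :: "('a::real_inner \<Rightarrow> real) \<Rightarrow> 'a \<Rightarrow> ereal" where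
  "conjugate f p = (SUP z. ereal (z \<bullet> p - f z))"

definition subdiff :: "('a::real_inner \<Rightarrow> real) \<Rightarrow> 'a \<Rightarrow> 'a set" where
  "subdiff f z = {p. \<forall>w. f w - f z \<ge> p \<bullet> (w - z)}"


section \<open>Integration of extended real functions\<close>

text \<open>
  The integrand of the dual problem may take infinite values and need not be
  measurable in time. The integral is meaningful for measurable integrands whose
  positive and negative parts are not both of infinite integral.
\<close>

definition ext_integral :: "'a measure \<Rightarrow> ('a \<Rightarrow> ereal) \<Rightarrow> ereal" where
  "ext_integral M f =
     enn2ereal (\<integral>\<^sup>+ t. e2ennreal (f t) \<partial>M) - enn2ereal (\<integral>\<^sup>+ t. e2ennreal (- f t) \<partial>M)"

definition ext_integral_exists :: "'a measure \<Rightarrow> ('a \<Rightarrow> ereal) \<Rightarrow> bool" where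
  "ext_integral_exists M f \<longleftrightarrow> f \<in> borel_measurable M \<and>
     ((\<integral>\<^sup>+ t. e2ennreal (f t) \<partial>M) < \<infinity> \<or> (\<integral>\<^sup>+ t. e2ennreal (- f t) \<partial>M) < \<infinity>)"


section \<open>Trajectories on the unit interval\<close>

definition abs_continuous_on :: "real \<Rightarrow> real \<Rightarrow> (real \<Rightarrow> 'a::real_normed_vector) \<Rightarrow> bool" where
  "abs_continuous_on a b f \<longleftrightarrow>
     (\<forall>\<epsilon>>0. \<exists>\<delta>>0. \<forall>D T. D division_of T \<longrightarrow> T \<subseteq> {a..b} \<longrightarrow> (\<Sum>K\<in>D. measure lborel K) < \<delta> \<longrightarrow>
        (\<Sum>K\<in>D. norm (f (Sup K) - f (Inf K))) < \<epsilon>)"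

text \<open>Iterated derivative, one-sided at the endpoints.\<close>

primrec tderiv :: "nat \<Rightarrow> (real \<Rightarrow> 'a::real_normed_vector) \<Rightarrow> real \<Rightarrow> 'a" where
  "tderiv 0 x = x"
| "tderiv (Suc j) x = (\<lambda>t. vector_derivative (tderiv j x) (at t within {0..1}))"

text \<open>
  \<open>x\<close> is absolutely continuous together with its derivatives of order \<open>< m\<close>, and its derivative
  of order \<open>m\<close> is integrable (used for \<open>m \<ge> 1\<close>). The explicit clauses on differentiability
  exclude the arbitrary values of \<^const>\<open>vector_derivative\<close>; the almost everywhere clause
  is automatic by Lebesgue's theorem on absolutely continuous functions.
\<close>

definition ac_order :: "nat \<Rightarrow> (real \<Rightarrow> 'a::euclidean_space) \<Rightarrow> bool" where
  "ac_order m x \<longleftrightarrow>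
     (\<forall>j<m. abs_continuous_on 0 1 (tderiv j x)) \<and>
     (\<forall>j. Suc j < m \<longrightarrow> (\<forall>t\<in>{0..1}.
        (tderiv j x has_vector_derivative tderiv (Suc j) x t) (at t within {0..1}))) \<and>
     (AE t in lebesgue_on {0..1}.
        (tderiv (m - 1) x has_vector_derivative tderiv m x t) (at t within {0..1})) \<and>
     integrable (lebesgue_on {0..1}) (tderiv m x)"

definition jet :: "(real \<Rightarrow> 'a::real_normed_vector) \<Rightarrow> real \<Rightarrow> 'a^'k::{finite,linorder}" where
  "jet x t = tuple (\<lambda>j. tderiv j x t)"


section \<open>The primary problem\<close>

definition feasible ::
  "((real^'n)^'k::{finite,linorder} \<Rightarrow> real \<Rightarrow> (real^'n) set) \<Rightarrow> (nat \<Rightarrow> (real^'n) set)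
    \<Rightarrow> (real \<Rightarrow> real^'n) \<Rightarrow> bool" where
  "feasible F Q x \<longleftrightarrow>
     ac_order CARD('k) x \<and>
     (AE t in lebesgue_on {0..1}. tderiv CARD('k) x t \<in> F (jet x t) t) \<and>
     (\<forall>j<CARD('k). tderiv j x 0 \<in> Q j)"

definition primal_optimal ::
  "((real^'n)^'k::{finite,linorder} \<Rightarrow> real) \<Rightarrow> ((real^'n)^'k::{finite,linorder} \<Rightarrow> real \<Rightarrow> (real^'n) set)
    \<Rightarrow> (nat \<Rightarrow> (real^'n) set) \<Rightarrow> (real \<Rightarrow> real^'n) \<Rightarrow> bool" where
  "primal_optimal \<phi> F Q x \<longleftrightarrow>
     feasible F Q x \<and> (\<forall>y. feasible F Q y \<longrightarrow> \<phi> (jet x 1) \<le> \<phi> (jet y 1))"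

definition primal_value ::
  "((real^'n)^'k::{finite,linorder} \<Rightarrow> real) \<Rightarrow> ((real^'n)^'k::{finite,linorder} \<Rightarrow> real \<Rightarrow> (real^'n) set)
    \<Rightarrow> (nat \<Rightarrow> (real^'n) set) \<Rightarrow> ereal" where
  "primal_value \<phi> F Q = (INF x\<in>{x. feasible F Q x}. ereal (\<phi> (jet x 1)))"


section \<open>The dual problem\<close>

text \<open>A family consists of \<open>xs\<close> and \<open>\<eta> j\<close> for \<open>1 \<le> j < \<kappa>\<close>; the value \<open>\<eta> 0\<close> is fixed to zero.\<close>

definition dual_family :: "nat \<Rightarrow> (real \<Rightarrow> real^'n) \<Rightarrow> (nat \<Rightarrow> real \<Rightarrow> real^'n) \<Rightarrow> bool" where
  "dual_family \<kappa> xs \<eta> \<longleftrightarrow>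
     ac_order \<kappa> xs \<and> (\<forall>j\<in>{1..<\<kappa>}. ac_order 1 (\<eta> j)) \<and> (\<forall>t\<in>{0..1}. \<eta> 0 t = 0)"

text \<open>
  The \<open>\<kappa>\<close>-tuple
  \<open>((-1)^\<kappa> xs\<^sup>(\<^sup>\<kappa>\<^sup>)(t) + \<eta>\<^sub>\<kappa>\<^sub>-\<^sub>1'(t), \<eta>\<^sub>\<kappa>\<^sub>-\<^sub>1(t) + \<eta>\<^sub>\<kappa>\<^sub>-\<^sub>2'(t), \<dots>, \<eta>\<^sub>2(t) + \<eta>\<^sub>1'(t), \<eta>\<^sub>1(t))\<close>.
\<close>

definition adj_tuple ::
  "(real \<Rightarrow> real^'n) \<Rightarrow> (nat \<Rightarrow> real \<Rightarrow> real^'n) \<Rightarrow> real \<Rightarrow> (real^'n)^'k::{finite,linorder}" where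
  "adj_tuple xs \<eta> t = tuple (\<lambda>i.
     (if i = 0 then (-1) ^ CARD('k) *\<^sub>R tderiv CARD('k) xs t else \<eta> (CARD('k) - i) t)
     + tderiv 1 (\<eta> (CARD('k) - 1 - i)) t)"

text \<open>
  The \<open>\<kappa>\<close>-tuple
  \<open>((-1)^\<kappa> xs\<^sup>(\<^sup>\<kappa>\<^sup>-\<^sup>1\<^sup>)(1) + \<eta>\<^sub>\<kappa>\<^sub>-\<^sub>1(1), (-1)^(\<kappa>-1) xs\<^sup>(\<^sup>\<kappa>\<^sup>-\<^sup>2\<^sup>)(1) + \<eta>\<^sub>\<kappa>\<^sub>-\<^sub>2(1), \<dots>, xs'(1) + \<eta>\<^sub>1(1), -xs(1))\<close>.
\<close>

definition end_tuple ::
  "(real \<Rightarrow> real^'n) \<Rightarrow> (nat \<Rightarrow> real \<Rightarrow> real^'n) \<Rightarrow> (real^'n)^'k::{finite,linorder}" where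
  "end_tuple xs \<eta> = tuple (\<lambda>i.
     (-1) ^ (CARD('k) - i) *\<^sub>R tderiv (CARD('k) - 1 - i) xs 1 + \<eta> (CARD('k) - 1 - i) 1)"

definition dual_integrand ::
  "((real^'n)^'k::{finite,linorder} \<Rightarrow> real \<Rightarrow> (real^'n) set)
    \<Rightarrow> (real \<Rightarrow> real^'n) \<Rightarrow> (nat \<Rightarrow> real \<Rightarrow> real^'n) \<Rightarrow> real \<Rightarrow> ereal" where
  "dual_integrand F xs \<eta> t = M_fun (\<lambda>z. F z t) (adj_tuple xs \<eta> t) (xs t)"

definition dual_objective ::
  "((real^'n)^'k::{finite,linorder} \<Rightarrow> real) \<Rightarrow> ((real^'n)^'k::{finite,linorder} \<Rightarrow> real \<Rightarrow> (real^'n) set)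
    \<Rightarrow> (nat \<Rightarrow> (real^'n) set) \<Rightarrow> (real \<Rightarrow> real^'n) \<Rightarrow> (nat \<Rightarrow> real \<Rightarrow> real^'n) \<Rightarrow> ereal" where
  "dual_objective \<phi> F Q xs \<eta> =
     - conjugate \<phi> (end_tuple xs \<eta>)
     + ext_integral (lebesgue_on {0..1}) (dual_integrand F xs \<eta>)
     - (\<Sum>j\<in>{1..<CARD('k)}. supp_fun (Q (CARD('k) - j - 1)) ((-1) ^ j *\<^sub>R tderiv j xs 0 - \<eta> j 0))
     - supp_fun (Q (CARD('k) - 1)) (xs 0)"

text \<open>The families over which the dual objective is maximized: those for which it is defined.\<close>

definition dual_admissible ::
  "((real^'n)^'k::{finite,linorder} \<Rightarrow> real \<Rightarrow> (real^'n) set)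
    \<Rightarrow> (real \<Rightarrow> real^'n) \<Rightarrow> (nat \<Rightarrow> real \<Rightarrow> real^'n) \<Rightarrow> bool" where
  "dual_admissible F xs \<eta> \<longleftrightarrow>
     dual_family CARD('k) xs \<eta> \<and>
     ext_integral_exists (lebesgue_on {0..1}) (dual_integrand F xs \<eta>)"

definition dual_optimal ::
  "((real^'n)^'k::{finite,linorder} \<Rightarrow> real) \<Rightarrow> ((real^'n)^'k::{finite,linorder} \<Rightarrow> real \<Rightarrow> (real^'n) set)
    \<Rightarrow> (nat \<Rightarrow> (real^'n) set) \<Rightarrow> (real \<Rightarrow> real^'n) \<Rightarrow> (nat \<Rightarrow> real \<Rightarrow> real^'n) \<Rightarrow> bool" where
  "dual_optimal \<phi> F Q xs \<eta> \<longleftrightarrow>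
     dual_admissible F xs \<eta> \<and>
     (\<forall>ys \<theta>. dual_admissible F ys \<theta> \<longrightarrow> dual_objective \<phi> F Q ys \<theta> \<le> dual_objective \<phi> F Q xs \<eta>)"

definition dual_value ::
  "((real^'n)^'k::{finite,linorder} \<Rightarrow> real) \<Rightarrow> ((real^'n)^'k::{finite,linorder} \<Rightarrow> real \<Rightarrow> (real^'n) set)
    \<Rightarrow> (nat \<Rightarrow> (real^'n) set) \<Rightarrow> ereal" where
  "dual_value \<phi> F Q = (SUP (xs, \<eta>)\<in>{(xs, \<eta>). dual_admissible F xs \<eta>}. dual_objective \<phi> F Q xs \<eta>)"


section \<open>Optimality conditions\<close>

definition adjoint_inclusion ::
  "((real^'n)^'k::{finite,linorder} \<Rightarrow> real \<Rightarrow> (real^'n) set) \<Rightarrow> (real \<Rightarrow> real^'n)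
    \<Rightarrow> (real \<Rightarrow> real^'n) \<Rightarrow> (nat \<Rightarrow> real \<Rightarrow> real^'n) \<Rightarrow> bool" where
  "adjoint_inclusion F x xs \<eta> \<longleftrightarrow>
     (AE t in lebesgue_on {0..1}.
        adj_tuple xs \<eta> t \<in> lam (\<lambda>z. F z t) (xs t) (jet x t, tderiv CARD('k) x t))"

definition initial_condition ::
  "nat \<Rightarrow> (nat \<Rightarrow> (real^'n) set) \<Rightarrow> (real \<Rightarrow> real^'n)
    \<Rightarrow> (real \<Rightarrow> real^'n) \<Rightarrow> (nat \<Rightarrow> real \<Rightarrow> real^'n) \<Rightarrow> bool" where
  "initial_condition \<kappa> Q x xs \<eta> \<longleftrightarrow>
     (\<forall>j\<in>{1..<\<kappa>}. (-1) ^ (j + 1) *\<^sub>R tderiv j xs 0 + \<eta> j 0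
        \<in> dual_cone (Q (\<kappa> - j - 1)) (tderiv (\<kappa> - j - 1) x 0)) \<and>
     - xs 0 \<in> dual_cone (Q (\<kappa> - 1)) (tderiv (\<kappa> - 1) x 0)"

definition transversality ::
  "((real^'n)^'k::{finite,linorder} \<Rightarrow> real) \<Rightarrow> (real \<Rightarrow> real^'n)
    \<Rightarrow> (real \<Rightarrow> real^'n) \<Rightarrow> (nat \<Rightarrow> real \<Rightarrow> real^'n) \<Rightarrow> bool" where
  "transversality \<phi> x xs \<eta> \<longleftrightarrow> end_tuple xs \<eta> \<in> subdiff \<phi> (jet x 1)"

definition maximum_condition ::
  "((real^'n)^'k::{finite,linorder} \<Rightarrow> real \<Rightarrow> (real^'n) set) \<Rightarrow> (real \<Rightarrow> real^'n)
    \<Rightarrow> (real \<Rightarrow> real^'n) \<Rightarrow> bool" where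
  "maximum_condition F x xs \<longleftrightarrow>
     (AE t in lebesgue_on {0..1}.
        tderiv CARD('k) x t \<in> argmax_set (\<lambda>z. F z t) (jet x t) (xs t))"

end

theory Submission
  imports Defs
begin

text \<open>
  The theorem is weak duality together with its equality case, for the single trajectory \<open>x\<close>. With
  \<open>E\<^sub>i = (-1)\<^sup>\<kappa>\<^sup>-\<^sup>i xs\<^sup>(\<^sup>\<kappa>\<^sup>-\<^sup>1\<^sup>-\<^sup>i\<^sup>) + \<eta>\<^sub>\<kappa>\<^sub>-\<^sub>1\<^sub>-\<^sub>i\<close> (the function \<open>costate\<close>) the derivative of
  \<open>\<Sum>\<^sub>i \<langle>x\<^sup>(\<^sup>i\<^sup>), E\<^sub>i\<rangle>\<close> telescopes to \<open>\<langle>jet x, adj_tuple\<rangle> - \<langle>x\<^sup>(\<^sup>\<kappa>\<^sup>), xs\<rangle>\<close>, so that the integral of the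
  latter is \<open>\<langle>jet x 1, end_tuple\<rangle> - \<Sum>\<^sub>i \<langle>x\<^sup>(\<^sup>i\<^sup>)(0), E\<^sub>i(0)\<rangle>\<close>. Hence \<open>\<phi> (jet x 1)\<close> is what the dual
  objective becomes when the three infima and suprema in it are evaluated at the trajectory:

  \<^item> \<open>\<phi>\<^sup>*\<close> at the point \<open>jet x 1\<close>,
  \<^item> \<open>M\<close> at the point \<open>(jet x t, x\<^sup>(\<^sup>\<kappa>\<^sup>)(t))\<close> of the graph of \<open>F(\<cdot>,t)\<close>,
  \<^item> the support function of \<open>Q\<^sub>i\<close> at the point \<open>x\<^sup>(\<^sup>i\<^sup>)(0)\<close>.

  Each evaluation can only increase the objective, which gives weak duality. It leaves the objective
  unchanged exactly if the points attain these infima and suprema, for \<open>M\<close> at almost every time.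
  Attainment in \<open>\<phi>\<^sup>*\<close> is the subgradient condition at the end point, attainment in \<open>M\<close> the adjoint
  inclusion, and attainment in the support functions the dual cone condition at the initial point.
  This is \<open>weak_duality\<close>. As \<open>x\<close> is optimal, \<open>\<phi> (jet x 1)\<close> is the primal value; a family satisfying
  the optimality conditions has this number as its dual objective. So the values agree, and a dual
  family is optimal if and only if it attains this number.

  Two ingredients come from analysis. The fundamental theorem of calculus is proved for absolutely
  continuous functions by means of the gauge integral, and carried through the product rule to inner
  products. The integral of the extended real integrand \<open>M\<close> is compared with that of a real integrable
  majorant (\<open>ext_integral_le_integral\<close>), including the case of equality.
\<close>

section \<open>The fundamental theorem of calculus for absolutely continuous functions\<close>

text \<open>
  This bridges the two kinds of partitions: absolute continuity speaks of divisions, a gauge integral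
  of tagged ones. Several tags may share a degenerate interval, which is lost when the tags are
  forgotten, but such an interval contributes nothing to the sum.
\<close>

lemma sum_norm_over_fine_tags_small:
  fixes f :: "real \<Rightarrow> 'a::real_normed_vector"
  assumes p: "p tagged_partial_division_of {a..b}"
    and small: "\<And>D T. D division_of T \<Longrightarrow> T \<subseteq> {a..b} \<Longrightarrow> (\<Sum>K\<in>D. measure lborel K) < \<delta> \<Longrightarrow>
        (\<Sum>K\<in>D. norm (f (Sup K) - f (Inf K))) < \<epsilon>"
    and U: "U \<in> lmeasurable" "measure lebesgue U < \<delta>" "\<And>t K. (t, K) \<in> p \<Longrightarrow> K \<subseteq> U"
  shows "(\<Sum>(t, K)\<in>p. norm (f (Sup K) - f (Inf K))) < \<epsilon>"
proof -
  let ?d = "\<lambda>K. if K = {} then 0 else norm (f (Sup K) - f (Inf K))"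
  note td = tagged_partial_division_of_Union_self[OF p]
  have div: "snd ` p division_of \<Union>(snd ` p)"
    by (rule division_of_tagged_division[OF td])
  have sub: "\<Union>(snd ` p) \<subseteq> {a..b}"
    using tagged_partial_division_ofD(3)[OF p] by fastforce
  have "(\<Sum>K\<in>snd ` p. measure lborel K) = (\<Sum>K\<in>snd ` p. measure lebesgue K)"
    using division_ofD(4)[OF div] by (intro sum.cong) (fastforce)+
  also have "\<dots> = measure lebesgue (\<Union>(snd ` p))"
    by (rule content_division[OF div])
  also have "\<dots> \<le> measure lebesgue U"
  proof (rule measure_mono_fmeasurable)
    show "\<Union> (snd ` p) \<subseteq> U" using U(3) by fastforce
    show "\<Union> (snd ` p) \<in> sets lebesgue"
      using lmeasurable_division[OF div] by (rule fmeasurableD)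
  qed (rule U(1))
  finally have "(\<Sum>K\<in>snd ` p. measure lborel K) < \<delta>" using U(2) by simp
  then have "(\<Sum>K\<in>snd ` p. norm (f (Sup K) - f (Inf K))) < \<epsilon>"
    by (rule small[OF div sub])
  moreover have "(\<Sum>K\<in>snd ` p. norm (f (Sup K) - f (Inf K))) = (\<Sum>K\<in>snd ` p. ?d K)"
    using division_ofD(3)[OF div] by (intro sum.cong) auto
  moreover have "(\<Sum>(t, K)\<in>p. ?d K) = (\<Sum>K\<in>snd ` p. ?d K)"
    by (rule sum.over_tagged_division_lemma[OF td]) auto
  moreover have "(\<Sum>(t, K)\<in>p. ?d K) = (\<Sum>(t, K)\<in>p. norm (f (Sup K) - f (Inf K)))"
    using tagged_partial_division_ofD(2)[OF p] by (intro sum.cong) fastforce+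
  ultimately show ?thesis by simp
qed

text \<open>
  Measured from a tag between the end points, the two errors of the linear approximation add up
  without loss because \<open>\<bar>u - t\<bar> + \<bar>v - t\<bar> = v - u\<close>.
\<close>

lemma straddle_estimate:
  fixes f :: "real \<Rightarrow> 'a::real_normed_vector"
  assumes near: "\<And>y. y \<in> {u, v} \<Longrightarrow> norm (f y - f t - (y - t) *\<^sub>R c) \<le> e * norm (y - t)"
    and "u \<le> t" "t \<le> v"
  shows "norm ((v - u) *\<^sub>R c - (f v - f u)) \<le> e * (v - u)"
proof -
  have "norm ((v - u) *\<^sub>R c - (f v - f u))
      = norm ((f u - f t - (u - t) *\<^sub>R c) - (f v - f t - (v - t) *\<^sub>R c))"
    by (simp add: algebra_simps)
  also have "\<dots> \<le> norm (f u - f t - (u - t) *\<^sub>R c) + norm (f v - f t - (v - t) *\<^sub>R c)"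
    by (rule norm_triangle_ineq4)
  also have "\<dots> \<le> e * (t - u) + e * (v - t)"
    using near[of u] near[of v] assms(2,3) by simp
  finally show ?thesis by (simp add: algebra_simps)
qed

text \<open>
  Off the null set \<open>N\<close> where the derivative fails to exist, the gauge is chosen as in the proof of the
  ordinary fundamental theorem. At the tags in \<open>N\<close> it confines the intervals to an open set of small
  measure containing \<open>N\<close>: by absolute continuity the increments of \<open>f\<close> over these intervals have
  a small sum, and the integrand may be set to zero there.
\<close>

theorem fundamental_theorem_absolutely_continuous:
  fixes f :: "real \<Rightarrow> 'a::banach"
  assumes "a \<le> b" and ac: "abs_continuous_on a b f"
    and deriv: "AE t in lebesgue_on {a..b}. (f has_vector_derivative f' t) (at t within {a..b})"
  shows "(f' has_integral (f b - f a)) {a..b}"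
proof -
  have "AE t in lebesgue. t \<in> {a..b} \<longrightarrow> (f has_vector_derivative f' t) (at t within {a..b})"
    using deriv by (subst (asm) AE_restrict_space_iff) auto
  then obtain N where N: "negligible N" and
    dN: "\<And>t. t \<in> {a..b} \<Longrightarrow> t \<notin> N \<Longrightarrow> (f has_vector_derivative f' t) (at t within {a..b})"
    unfolding eventually_ae_filter_negligible by blast
  define g where "g t = (if t \<in> N then 0 else f' t)" for t
  have "(g has_integral (f b - f a)) {a..b}"
    unfolding has_integral_real
  proof (intro allI impI)
    fix e :: real assume "e > 0"
    \<comment> \<open>The summand 1 keeps the denominator positive when the interval is degenerate.\<close>
    define e' where "e' = e / (2 * (b - a + 1))"
    have "e' > 0" and e'ba: "e' * (b - a) \<le> e / 2"
      using \<open>e > 0\<close> \<open>a \<le> b\<close> by (auto simp: e'_def field_simps)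
    obtain \<delta> where "\<delta> > 0" and \<delta>: "\<And>D T. D division_of T \<Longrightarrow> T \<subseteq> {a..b} \<Longrightarrow>
        (\<Sum>K\<in>D. measure lborel K) < \<delta> \<Longrightarrow> (\<Sum>K\<in>D. norm (f (Sup K) - f (Inf K))) < e / 2"
      using ac \<open>e > 0\<close> unfolding abs_continuous_on_def by (meson half_gt_zero)
    obtain U where U: "open U" "N \<subseteq> U" "U - N \<in> lmeasurable" "emeasure lebesgue (U - N) < ennreal \<delta>"
      using sets_lebesgue_outer_open[OF negligible_imp_sets[OF N] \<open>\<delta> > 0\<close>] .
    have Nm: "N \<in> lmeasurable" using N by (rule negligible_imp_measurable)
    have Uun: "U = (U - N) \<union> N" using U(2) by blast
    have Um: "U \<in> lmeasurable" using fmeasurable.Un[OF U(3) Nm] Uun by metis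
    have "measure lebesgue (U - N) = measure lebesgue U"
      using N Um by (simp add: measure_Diff_null_set negligible_iff_null_sets fmeasurableD)
    then have U\<delta>: "measure lebesgue U < \<delta>"
      using U(3,4) \<open>\<delta> > 0\<close> by (simp add: emeasure_eq_measure2 ennreal_less_iff)
    have "\<exists>r>0. (t \<in> N \<longrightarrow> ball t r \<subseteq> U) \<and>
        (t \<in> {a..b} - N \<longrightarrow> (\<forall>y\<in>{a..b}. norm (y - t) < r \<longrightarrow>
            norm (f y - f t - (y - t) *\<^sub>R f' t) \<le> e' * norm (y - t)))" for t
    proof (cases "t \<in> N")
      case True
      then show ?thesis using U(1,2) open_contains_ball by blast
    next
      case False
      then show ?thesis
        using dN[of t] \<open>e' > 0\<close> zero_less_one
        unfolding has_vector_derivative_def has_derivative_within_alt by blast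
    qed
    then obtain r where r0: "\<And>t. r t > 0" and rU: "\<And>t. t \<in> N \<Longrightarrow> ball t (r t) \<subseteq> U"
      and rd: "\<And>t y. \<lbrakk>t \<in> {a..b}; t \<notin> N; y \<in> {a..b}; norm (y - t) < r t\<rbrakk>
          \<Longrightarrow> norm (f y - f t - (y - t) *\<^sub>R f' t) \<le> e' * norm (y - t)"
      by (metis (no_types, lifting) DiffI)
    show "\<exists>\<gamma>. gauge \<gamma> \<and> (\<forall>\<D>. \<D> tagged_division_of {a..b} \<and> \<gamma> fine \<D> \<longrightarrow>
        norm ((\<Sum>(t, K)\<in>\<D>. measure lborel K *\<^sub>R g t) - (f b - f a)) < e)"
    proof (intro exI conjI allI impI; (elim conjE)?)
      show "gauge (\<lambda>t. ball t (r t))" using r0 gauge_ball_dependent by blast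
      fix p assume p: "p tagged_division_of {a..b}" and fine: "(\<lambda>t. ball t (r t)) fine p"
      have pp: "p tagged_partial_division_of {a..b}" using p by (simp add: tagged_division_of_def)
      have finp: "finite p" using p by blast
      let ?h = "\<lambda>(t, K). measure lborel K *\<^sub>R g t - (f (Sup K) - f (Inf K))"
      let ?A = "{q \<in> p. fst q \<notin> N}" and ?B = "{q \<in> p. fst q \<in> N}"
      have good: "norm (?h (t, K)) \<le> e' * (Sup K - Inf K) \<and> Inf K \<le> Sup K" if tK: "(t, K) \<in> ?A" for t K
      proof -
        obtain u v where K: "K = cbox u v" using p tK by blast
        have t: "t \<in> K" "K \<subseteq> {a..b}" using p tK by auto
        then have uv: "u \<le> t" "t \<le> v" "u \<in> K" "v \<in> K" unfolding K by auto
        have "K \<subseteq> ball t (r t)" using fine tK by (auto simp: fine_def)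
        then have "norm (f y - f t - (y - t) *\<^sub>R f' t) \<le> e' * norm (y - t)" if "y \<in> {u, v}" for y
          using that uv t tK by (intro rd) (auto simp: dist_real_def subset_iff abs_minus_commute)
        from straddle_estimate[of u v, OF this uv(1,2)] show ?thesis
          using uv tK by (auto simp: K g_def)
      qed
      have "norm (\<Sum>q\<in>?A. ?h q) \<le> (\<Sum>q\<in>?A. e' * (Sup (snd q) - Inf (snd q)))"
        using good by (intro sum_norm_le) force
      also have "\<dots> \<le> (\<Sum>q\<in>p. e' * (Sup (snd q) - Inf (snd q)))"
      proof (rule sum_mono2[OF finp])
        fix q assume q: "q \<in> p - ?A"
        obtain t K where tK: "q = (t, K)" by (cases q)
        obtain u v where K: "K = cbox u v" and "t \<in> K" using p q tK by blast
        then have "u \<le> v" by auto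
        then show "0 \<le> e' * (Sup (snd q) - Inf (snd q))" using K tK \<open>e' > 0\<close> by simp
      qed auto
      also have "\<dots> = e' * (b - a)"
        using additive_tagged_division_1[OF \<open>a \<le> b\<close> p, of "\<lambda>t. t"]
        by (simp add: sum_distrib_left[symmetric] split_def)
      finally have A: "norm (\<Sum>q\<in>?A. ?h q) \<le> e / 2" using e'ba by simp
      have "norm (\<Sum>q\<in>?B. ?h q) \<le> (\<Sum>(t, K)\<in>?B. norm (f (Sup K) - f (Inf K)))"
        by (intro sum_norm_le) (auto simp: g_def norm_minus_commute)
      also have "\<dots> < e / 2"
      proof (rule sum_norm_over_fine_tags_small[OF _ \<delta> Um U\<delta>])
        show "?B tagged_partial_division_of {a..b}" by (rule tagged_partial_division_subset[OF pp]) auto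
        fix t K assume "(t, K) \<in> ?B"
        then show "K \<subseteq> U" using fine rU[of t] by (fastforce simp: fine_def)
      qed
      finally have B: "norm (\<Sum>q\<in>?B. ?h q) < e / 2" .
      have "(\<Sum>(t, K)\<in>p. measure lborel K *\<^sub>R g t) - (f b - f a) = (\<Sum>q\<in>p. ?h q)"
        using additive_tagged_division_1[OF \<open>a \<le> b\<close> p, of f] by (simp add: split_def sum_subtractf)
      also have "\<dots> = (\<Sum>q\<in>?A. ?h q) + (\<Sum>q\<in>?B. ?h q)"
        by (subst sum.union_disjoint[symmetric]) (auto simp: finp intro!: sum.cong)
      finally have split: "(\<Sum>(t, K)\<in>p. measure lborel K *\<^sub>R g t) - (f b - f a) = (\<Sum>q\<in>?A. ?h q) + (\<Sum>q\<in>?B. ?h q)" .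
      have "norm ((\<Sum>q\<in>?A. ?h q) + (\<Sum>q\<in>?B. ?h q)) < e / 2 + e / 2"
        by (rule order_le_less_trans[OF norm_triangle_ineq add_le_less_mono[OF A B]])
      then show "norm ((\<Sum>(t, K)\<in>p. measure lborel K *\<^sub>R g t) - (f b - f a)) < e"
        unfolding split by simp
    qed
  qed
  then show ?thesis
    by (rule has_integral_spike[OF N, rotated]) (simp add: g_def)
qed


section \<open>Calculus of absolutely continuous functions\<close>

text \<open>
  The hypotheses needed to integrate \<open>f'\<close> by the fundamental theorem, bundled so that they are
  preserved together by sums, scalar multiples and inner products.
\<close>

definition ac_antiderivative :: "real \<Rightarrow> real \<Rightarrow> (real \<Rightarrow> 'a::euclidean_space) \<Rightarrow> (real \<Rightarrow> 'a) \<Rightarrow> bool" where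
  "ac_antiderivative a b f f' \<longleftrightarrow> abs_continuous_on a b f \<and>
     (AE t in lebesgue_on {a..b}. (f has_vector_derivative f' t) (at t within {a..b})) \<and>
     integrable (lebesgue_on {a..b}) f'"

lemma abs_continuous_on_imp_continuous_on:
  fixes f :: "real \<Rightarrow> 'a::real_normed_vector"
  assumes "abs_continuous_on a b f"
  shows "continuous_on {a..b} f"
  unfolding continuous_on_iff
proof (intro ballI allI impI)
  fix s and \<epsilon> :: real assume s: "s \<in> {a..b}" and "\<epsilon> > 0"
  then obtain \<delta> where "\<delta> > 0" and \<delta>: "\<And>D T. D division_of T \<Longrightarrow> T \<subseteq> {a..b} \<Longrightarrow>
        (\<Sum>K\<in>D. measure lborel K) < \<delta> \<Longrightarrow> (\<Sum>K\<in>D. norm (f (Sup K) - f (Inf K))) < \<epsilon>"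
    using assms unfolding abs_continuous_on_def by meson
  have small: "norm (f v - f u) < \<epsilon>" if "u \<le> v" "v - u < \<delta>" "{u..v} \<subseteq> {a..b}" for u v
    using \<delta>[OF division_of_self[of u v]] that by auto
  have "dist (f t) (f s) < \<epsilon>" if "t \<in> {a..b}" "dist t s < \<delta>" for t
  proof (cases "s \<le> t")
    case True
    then show ?thesis using small[of s t] s that by (auto simp: dist_norm)
  next
    case False
    then show ?thesis using small[of t s] s that by (auto simp: dist_norm norm_minus_commute)
  qed
  then show "\<exists>d>0. \<forall>t\<in>{a..b}. dist t s < d \<longrightarrow> dist (f t) (f s) < \<epsilon>"
    using \<open>\<delta> > 0\<close> by blast
qed

text \<open>
  A common source of the closure properties: a function whose increments are dominated by those of two
  absolutely continuous functions is absolutely continuous.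
\<close>

lemma abs_continuous_on_combine:
  fixes f :: "real \<Rightarrow> 'a::real_normed_vector" and g :: "real \<Rightarrow> 'b::real_normed_vector"
    and h :: "real \<Rightarrow> 'c::real_normed_vector"
  assumes f: "abs_continuous_on a b f" and g: "abs_continuous_on a b g" and "B > 0"
    and h: "\<And>u v. u \<in> {a..b} \<Longrightarrow> v \<in> {a..b} \<Longrightarrow> norm (h v - h u) \<le> B * (norm (f v - f u) + norm (g v - g u))"
  shows "abs_continuous_on a b h"
  unfolding abs_continuous_on_def
proof (intro allI impI)
  fix \<epsilon> :: real assume "\<epsilon> > 0"
  then have e: "\<epsilon> / (2 * B) > 0" using \<open>B > 0\<close> by simp
  obtain d1 where d1: "d1 > 0" "\<And>D T. D division_of T \<Longrightarrow> T \<subseteq> {a..b} \<Longrightarrow>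
        (\<Sum>K\<in>D. measure lborel K) < d1 \<Longrightarrow> (\<Sum>K\<in>D. norm (f (Sup K) - f (Inf K))) < \<epsilon> / (2 * B)"
    using f e unfolding abs_continuous_on_def by meson
  obtain d2 where d2: "d2 > 0" "\<And>D T. D division_of T \<Longrightarrow> T \<subseteq> {a..b} \<Longrightarrow>
        (\<Sum>K\<in>D. measure lborel K) < d2 \<Longrightarrow> (\<Sum>K\<in>D. norm (g (Sup K) - g (Inf K))) < \<epsilon> / (2 * B)"
    using g e unfolding abs_continuous_on_def by meson
  have "(\<Sum>K\<in>D. norm (h (Sup K) - h (Inf K))) < \<epsilon>"
    if D: "D division_of T" "T \<subseteq> {a..b}" and s: "(\<Sum>K\<in>D. measure lborel K) < min d1 d2" for D T
  proof -
    have "(\<Sum>K\<in>D. norm (h (Sup K) - h (Inf K)))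
        \<le> (\<Sum>K\<in>D. B * (norm (f (Sup K) - f (Inf K)) + norm (g (Sup K) - g (Inf K))))"
    proof (rule sum_mono)
      fix K assume K: "K \<in> D"
      obtain u v where uv: "K = cbox u v" using division_ofD(4)[OF D(1) K] by blast
      have "K \<noteq> {}" "K \<subseteq> {a..b}" using division_ofD(2,3)[OF D(1) K] D(2) by auto
      then have "Sup K \<in> {a..b}" "Inf K \<in> {a..b}" by (auto simp: uv)
      then show "norm (h (Sup K) - h (Inf K))
          \<le> B * (norm (f (Sup K) - f (Inf K)) + norm (g (Sup K) - g (Inf K)))" by (rule h[rotated])
    qed
    also have "\<dots> = B * ((\<Sum>K\<in>D. norm (f (Sup K) - f (Inf K))) + (\<Sum>K\<in>D. norm (g (Sup K) - g (Inf K))))"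
      by (simp add: sum_distrib_left[symmetric] sum.distrib)
    also have "\<dots> < B * (\<epsilon> / (2 * B) + \<epsilon> / (2 * B))"
      using d1(2)[OF D] d2(2)[OF D] s \<open>B > 0\<close> by (intro mult_strict_left_mono add_strict_mono) auto
    also have "\<dots> = \<epsilon>" using \<open>B > 0\<close> by (simp add: field_simps)
    finally show ?thesis .
  qed
  then show "\<exists>\<delta>>0. \<forall>D T. D division_of T \<longrightarrow> T \<subseteq> {a..b} \<longrightarrow> (\<Sum>K\<in>D. measure lborel K) < \<delta> \<longrightarrow>
      (\<Sum>K\<in>D. norm (h (Sup K) - h (Inf K))) < \<epsilon>"
    using d1(1) d2(1) by (intro exI[of _ "min d1 d2"]) auto
qed

lemma integrable_inner_continuous:
  fixes f g :: "real \<Rightarrow> 'a::euclidean_space"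
  assumes f: "continuous_on {a..b} f" and g: "integrable (lebesgue_on {a..b}) g"
  shows "integrable (lebesgue_on {a..b}) (\<lambda>t. f t \<bullet> g t)"
proof -
  have "bounded (f ` {a..b})"
    by (intro compact_imp_bounded compact_continuous_image f compact_Icc)
  then obtain B where B: "\<And>t. t \<in> {a..b} \<Longrightarrow> norm (f t) \<le> B" unfolding bounded_iff by blast
  have [measurable]: "f \<in> borel_measurable (lebesgue_on {a..b})"
    using f by (intro continuous_imp_measurable_on_sets_lebesgue) auto
  have [measurable]: "g \<in> borel_measurable (lebesgue_on {a..b})" using g by auto
  show ?thesis
  proof (rule Bochner_Integration.integrable_bound)
    show "integrable (lebesgue_on {a..b}) (\<lambda>t. B *\<^sub>R g t)" using g by (rule integrable_scaleR_right)
    have "norm (f t \<bullet> g t) \<le> norm (B *\<^sub>R g t)" if "t \<in> {a..b}" for t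
    proof -
      have "norm (f t \<bullet> g t) \<le> norm (f t) * norm (g t)" by (simp add: Cauchy_Schwarz_ineq2)
      also have "\<dots> \<le> B * norm (g t)" using B[OF that] by (intro mult_right_mono) auto
      also have "\<dots> \<le> norm (B *\<^sub>R g t)" by (simp add: mult_right_mono)
      finally show ?thesis .
    qed
    then show "AE t in lebesgue_on {a..b}. norm (f t \<bullet> g t) \<le> norm (B *\<^sub>R g t)"
      by (intro AE_I2) auto
  qed measurable
qed

lemma ac_antiderivative_zero: "ac_antiderivative a b (\<lambda>t. 0) (\<lambda>t. 0)"
  by (auto simp: ac_antiderivative_def abs_continuous_on_def)

lemma ac_antiderivative_add:
  assumes "ac_antiderivative a b f f'" "ac_antiderivative a b g g'"
  shows "ac_antiderivative a b (\<lambda>t. f t + g t) (\<lambda>t. f' t + g' t)"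
  unfolding ac_antiderivative_def
proof (intro conjI)
  show "abs_continuous_on a b (\<lambda>t. f t + g t)"
    by (rule abs_continuous_on_combine[of a b f g 1])
       (use assms in \<open>auto simp: ac_antiderivative_def norm_diff_triangle_ineq\<close>)
  show "AE t in lebesgue_on {a..b}. ((\<lambda>t. f t + g t) has_vector_derivative f' t + g' t) (at t within {a..b})"
  proof -
    have "AE t in lebesgue_on {a..b}. (f has_vector_derivative f' t) (at t within {a..b})"
      "AE t in lebesgue_on {a..b}. (g has_vector_derivative g' t) (at t within {a..b})"
      using assms by (auto simp: ac_antiderivative_def)
    then show ?thesis by eventually_elim (rule has_vector_derivative_add)
  qed
qed (use assms in \<open>auto simp: ac_antiderivative_def\<close>)

lemma ac_antiderivative_scaleR:
  assumes "ac_antiderivative a b f f'"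
  shows "ac_antiderivative a b (\<lambda>t. c *\<^sub>R f t) (\<lambda>t. c *\<^sub>R f' t)"
  unfolding ac_antiderivative_def
proof (intro conjI)
  have "norm (c *\<^sub>R f v - c *\<^sub>R f u) \<le> (\<bar>c\<bar> + 1) * (norm (f v - f u) + norm (f v - f u))" for u v
  proof -
    have "norm (c *\<^sub>R f v - c *\<^sub>R f u) = \<bar>c\<bar> * norm (f v - f u)"
      by (metis norm_scaleR scaleR_diff_right)
    also have "\<dots> \<le> (\<bar>c\<bar> + 1) * (norm (f v - f u) + norm (f v - f u))"
      by (intro mult_mono) auto
    finally show ?thesis .
  qed
  then show "abs_continuous_on a b (\<lambda>t. c *\<^sub>R f t)"
    using assms unfolding ac_antiderivative_def
    by - (rule abs_continuous_on_combine[of a b f f "\<bar>c\<bar> + 1"], auto)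
  show "AE t in lebesgue_on {a..b}. ((\<lambda>t. c *\<^sub>R f t) has_vector_derivative c *\<^sub>R f' t) (at t within {a..b})"
  proof -
    have "AE t in lebesgue_on {a..b}. (f has_vector_derivative f' t) (at t within {a..b})"
      using assms by (auto simp: ac_antiderivative_def)
    then show ?thesis
      by eventually_elim (rule bounded_linear.has_vector_derivative[OF bounded_linear_scaleR_right])
  qed
qed (use assms in \<open>auto simp: ac_antiderivative_def\<close>)

lemma ac_antiderivative_sum:
  assumes "\<And>i. i \<in> I \<Longrightarrow> ac_antiderivative a b (f i) (f' i)"
  shows "ac_antiderivative a b (\<lambda>t. \<Sum>i\<in>I. f i t) (\<lambda>t. \<Sum>i\<in>I. f' i t)"
  using assms
  by (induction I rule: infinite_finite_induct)
     (auto intro: ac_antiderivative_zero ac_antiderivative_add)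

lemma ac_antiderivative_inner:
  assumes f: "ac_antiderivative a b f f'" and g: "ac_antiderivative a b g g'"
  shows "ac_antiderivative a b (\<lambda>t. f t \<bullet> g t) (\<lambda>t. f t \<bullet> g' t + f' t \<bullet> g t)"
  unfolding ac_antiderivative_def
proof (intro conjI)
  have cf: "continuous_on {a..b} f" and cg: "continuous_on {a..b} g"
    using f g by (auto simp: ac_antiderivative_def intro: abs_continuous_on_imp_continuous_on)
  have "bounded (f ` {a..b})" "bounded (g ` {a..b})"
    by (intro compact_imp_bounded compact_continuous_image cf cg compact_Icc)+
  then obtain A B where AB: "A > 0" "B > 0" "\<And>t. t \<in> {a..b} \<Longrightarrow> norm (f t) \<le> A" "\<And>t. t \<in> {a..b} \<Longrightarrow> norm (g t) \<le> B"
    unfolding bounded_pos by auto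
  have "norm (f v \<bullet> g v - f u \<bullet> g u) \<le> (A + B) * (norm (f v - f u) + norm (g v - g u))"
    if uv: "u \<in> {a..b}" "v \<in> {a..b}" for u v
  proof -
    have "f v \<bullet> g v - f u \<bullet> g u = (f v - f u) \<bullet> g v + f u \<bullet> (g v - g u)"
      by (simp add: inner_diff_left inner_diff_right)
    then have "norm (f v \<bullet> g v - f u \<bullet> g u) \<le> norm (f v - f u) * norm (g v) + norm (f u) * norm (g v - g u)"
      using norm_triangle_ineq[of "(f v - f u) \<bullet> g v" "f u \<bullet> (g v - g u)"]
        Cauchy_Schwarz_ineq2[of "f v - f u" "g v"] Cauchy_Schwarz_ineq2[of "f u" "g v - g u"]
      unfolding real_norm_def by linarith
    also have "\<dots> \<le> norm (f v - f u) * (A + B) + (A + B) * norm (g v - g u)"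
      using AB(1,2) AB(3)[OF uv(1)] AB(4)[OF uv(2)] by (intro add_mono mult_mono) auto
    finally show ?thesis by (simp add: distrib_left mult.commute)
  qed
  then show "abs_continuous_on a b (\<lambda>t. f t \<bullet> g t)"
    using f g AB(1,2) unfolding ac_antiderivative_def
    by - (rule abs_continuous_on_combine[of a b f g "A + B"], auto)
  show "AE t in lebesgue_on {a..b}.
      ((\<lambda>t. f t \<bullet> g t) has_vector_derivative f t \<bullet> g' t + f' t \<bullet> g t) (at t within {a..b})"
  proof -
    have "AE t in lebesgue_on {a..b}. (f has_vector_derivative f' t) (at t within {a..b})"
      "AE t in lebesgue_on {a..b}. (g has_vector_derivative g' t) (at t within {a..b})"
      using f g by (auto simp: ac_antiderivative_def)
    then show ?thesis
      by eventually_elim (rule bounded_bilinear.has_vector_derivative[OF bounded_bilinear_inner])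
  qed
  have "integrable (lebesgue_on {a..b}) (\<lambda>t. f t \<bullet> g' t)" "integrable (lebesgue_on {a..b}) (\<lambda>t. g t \<bullet> f' t)"
    using f g by (auto intro!: integrable_inner_continuous cf cg simp: ac_antiderivative_def)
  then show "integrable (lebesgue_on {a..b}) (\<lambda>t. f t \<bullet> g' t + f' t \<bullet> g t)"
    by (simp add: inner_commute)
qed

lemma lebesgue_integral_ac_antiderivative:
  assumes "a \<le> b" "ac_antiderivative a b f f'"
  shows "integral\<^sup>L (lebesgue_on {a..b}) f' = f b - f a"
proof -
  have "(f' has_integral (f b - f a)) {a..b}"
    using assms unfolding ac_antiderivative_def by (intro fundamental_theorem_absolutely_continuous) auto
  moreover have "(f' has_integral integral\<^sup>L (lebesgue_on {a..b}) f') {a..b}"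
    using assms unfolding ac_antiderivative_def by (intro has_integral_integral_lebesgue_on) auto
  ultimately show ?thesis by (rule has_integral_unique[rotated])
qed


section \<open>Attainment of conjugates, support functions and the function M\<close>

text \<open>
  All the optimality conditions below are instances of this reading of the dual cone: its elements are
  the functionals that attain their minimum over \<open>A\<close> at \<open>z\<close>.
\<close>

lemma dual_cone_iff_minimizes:
  assumes "z \<in> A"
  shows "p \<in> dual_cone A z \<longleftrightarrow> (\<forall>w\<in>A. z \<bullet> p \<le> w \<bullet> p)"
proof
  assume p: "p \<in> dual_cone A z"
  show "\<forall>w\<in>A. z \<bullet> p \<le> w \<bullet> p"
  proof
    fix w assume "w \<in> A"
    then have "1 *\<^sub>R (w - z) \<in> tangent_cone A z" unfolding tangent_cone_def using zero_less_one by blast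
    then show "z \<bullet> p \<le> w \<bullet> p" using p unfolding dual_cone_def by (auto simp: inner_diff_left)
  qed
next
  assume "\<forall>w\<in>A. z \<bullet> p \<le> w \<bullet> p"
  then show "p \<in> dual_cone A z"
    unfolding dual_cone_def tangent_cone_def by (auto simp: inner_diff_left)
qed

lemma Inf_eq_attained_iff:
  fixes f :: "'a \<Rightarrow> real"
  assumes "z \<in> A"
  shows "(INF w\<in>A. ereal (f w)) = ereal (f z) \<longleftrightarrow> (\<forall>w\<in>A. f z \<le> f w)"
proof
  assume "(INF w\<in>A. ereal (f w)) = ereal (f z)"
  then show "\<forall>w\<in>A. f z \<le> f w" by (metis INF_lower ereal_less_eq(3))
next
  assume "\<forall>w\<in>A. f z \<le> f w"
  then show "(INF w\<in>A. ereal (f w)) = ereal (f z)"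
    using assms by (intro antisym INF_lower INF_greatest) auto
qed

lemma Sup_eq_attained_iff:
  fixes f :: "'a \<Rightarrow> real"
  assumes "z \<in> A"
  shows "(SUP w\<in>A. ereal (f w)) = ereal (f z) \<longleftrightarrow> (\<forall>w\<in>A. f w \<le> f z)"
proof
  assume "(SUP w\<in>A. ereal (f w)) = ereal (f z)"
  then show "\<forall>w\<in>A. f w \<le> f z" by (metis SUP_upper ereal_less_eq(3))
next
  assume "\<forall>w\<in>A. f w \<le> f z"
  then show "(SUP w\<in>A. ereal (f w)) = ereal (f z)"
    using assms by (intro antisym SUP_upper SUP_least) auto
qed

lemma M_fun_le:
  assumes "v \<in> F z"
  shows "M_fun F p q \<le> ereal (z \<bullet> p - v \<bullet> q)"
  unfolding M_fun_def using assms by (intro INF_lower2[of "(z, v)"]) (auto simp: gph_def)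

text \<open>
  The pairing \<open>\<langle>z, p\<rangle> - \<langle>v, q\<rangle>\<close> is the inner product with \<open>(p, -q)\<close>, whence the sign in the
  definition of the locally adjoint mapping.
\<close>

lemma M_fun_attained_iff:
  assumes "v \<in> F z"
  shows "M_fun F p q = ereal (z \<bullet> p - v \<bullet> q) \<longleftrightarrow> p \<in> lam F q (z, v)"
proof -
  have zv: "(z, v) \<in> gph F" using assms by (simp add: gph_def)
  have "M_fun F p q = (INF w\<in>gph F. ereal (w \<bullet> (p, - q)))"
    unfolding M_fun_def by (intro INF_cong) (auto simp: inner_prod_def)
  then show ?thesis
    using Inf_eq_attained_iff[OF zv, of "\<lambda>w. w \<bullet> (p, - q)"] dual_cone_iff_minimizes[OF zv, of "(p, - q)"]
    by (simp add: lam_def)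
qed

lemma supp_fun_ge:
  assumes "y \<in> Q"
  shows "ereal (y \<bullet> p) \<le> supp_fun Q p"
  unfolding supp_fun_def using assms by (rule SUP_upper)

lemma supp_fun_attained_iff:
  assumes "y \<in> Q"
  shows "supp_fun Q p = ereal (y \<bullet> p) \<longleftrightarrow> - p \<in> dual_cone Q y"
  unfolding supp_fun_def dual_cone_iff_minimizes[OF assms]
  using Sup_eq_attained_iff[OF assms, of "\<lambda>y. y \<bullet> p"] by simp

lemma conjugate_ge: "ereal (z \<bullet> p - f z) \<le> conjugate f p"
  unfolding conjugate_def by (rule SUP_upper) simp

lemma conjugate_attained_iff: "conjugate f p = ereal (z \<bullet> p - f z) \<longleftrightarrow> p \<in> subdiff f z"
  unfolding conjugate_def subdiff_def
  using Sup_eq_attained_iff[of z UNIV "\<lambda>z. z \<bullet> p - f z"]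
  by (auto simp: inner_diff_right inner_commute[of p] algebra_simps)


section \<open>Integrals of extended real functions\<close>

lemma complete_measure_lebesgue_on:
  assumes "S \<in> sets lebesgue"
  shows "complete_measure (lebesgue_on S)"
proof
  fix A B assume "A \<subseteq> B" "B \<in> null_sets (lebesgue_on S)"
  then have "B \<in> null_sets lebesgue" "B \<subseteq> S"
    using assms by (auto simp: null_sets_restrict_space)
  then have "A \<in> sets lebesgue" using \<open>A \<subseteq> B\<close> completion.complete by blast
  then show "A \<in> sets (lebesgue_on S)"
    using assms \<open>A \<subseteq> B\<close> \<open>B \<subseteq> S\<close> by (auto simp: sets_restrict_space_iff)
qed

text \<open>
  The adjoint inclusion determines the dual integrand only almost everywhere; its measurability
  follows from completeness of the measure.
\<close>

lemma (in complete_measure) measurable_AE_cong: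
  assumes f: "f \<in> borel_measurable M" and eq: "AE t in M. g t = f t"
  shows "g \<in> borel_measurable M"
proof (rule measurableI)
  fix A :: "'b set" assume "A \<in> sets borel"
  then have "f -` A \<inter> space M \<in> sets M" using f by (rule measurable_sets[rotated])
  then show "g -` A \<inter> space M \<in> sets M"
    by (rule in_sets_AE[rotated]) (use eq in \<open>auto elim: eventually_mono\<close>)
qed simp

lemma ext_integral_real:
  fixes h :: "'a \<Rightarrow> real"
  assumes "integrable M h"
  shows "ext_integral M (\<lambda>t. ereal (h t)) = ereal (integral\<^sup>L M h)"
proof -
  have fin: "(\<integral>\<^sup>+ t. ennreal (h t) \<partial>M) < \<infinity>" "(\<integral>\<^sup>+ t. ennreal (- h t) \<partial>M) < \<infinity>"
    using assms by (auto simp: real_integrable_def top.not_eq_extremum)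
  have *: "enn2ereal a - enn2ereal b = ereal (enn2real a - enn2real b)" if "a < \<infinity>" "b < \<infinity>" for a b
    using that by (cases a; cases b) (auto simp: enn2ereal_ennreal)
  show ?thesis
    unfolding ext_integral_def real_lebesgue_integral_def[OF assms]
    using *[OF fin] by simp
qed

lemma ext_integral_cong_AE:
  assumes "AE t in M. f t = g t"
  shows "ext_integral M f = ext_integral M g"
proof -
  have "(\<integral>\<^sup>+ t. e2ennreal (f t) \<partial>M) = (\<integral>\<^sup>+ t. e2ennreal (g t) \<partial>M)"
    by (intro nn_integral_cong_AE eventually_mono[OF assms]) simp
  moreover have "(\<integral>\<^sup>+ t. e2ennreal (- f t) \<partial>M) = (\<integral>\<^sup>+ t. e2ennreal (- g t) \<partial>M)"
    by (intro nn_integral_cong_AE eventually_mono[OF assms]) simp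
  ultimately show ?thesis unfolding ext_integral_def by simp
qed

text \<open>
  The difference \<open>g - f\<close> is nonnegative and, \<open>f\<close> having a finite integral, integrates to zero.
\<close>

lemma nn_integral_eq_imp_AE_eq:
  assumes [measurable]: "f \<in> borel_measurable M" "g \<in> borel_measurable M"
    and le: "AE t in M. f t \<le> g t" and eq: "integral\<^sup>N M f = integral\<^sup>N M g" and fin: "integral\<^sup>N M f < \<infinity>"
  shows "AE t in M. f t = g t"
proof -
  have "(\<integral>\<^sup>+ t. g t - f t \<partial>M) = integral\<^sup>N M g - integral\<^sup>N M f"
    using fin by (intro nn_integral_diff le) auto
  also have "\<dots> = 0" using eq fin by simp
  finally have "AE t in M. g t - f t = 0"
    by (subst (asm) nn_integral_0_iff_AE) auto
  then show ?thesis using le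
    by eventually_elim (meson antisym diff_eq_0_iff_ennreal ennreal_minus_eq_0)
qed

text \<open>
  The bound \<open>f \<le> h\<close> makes the positive part of \<open>f\<close> smaller and the negative part larger than those
  of \<open>h\<close>. Both parts of \<open>h\<close> have finite integrals, so if the differences agree, then the integrals
  of the two parts agree separately, and with them the parts themselves almost everywhere. The
  integral of \<open>f\<close> itself may be \<open>-\<infinity>\<close>.
\<close>

lemma ext_integral_le_integral:
  fixes h :: "'a \<Rightarrow> real"
  assumes h: "integrable M h" and le: "AE t in M. f t \<le> ereal (h t)" and f: "f \<in> borel_measurable M"
  shows "ext_integral M f \<le> ereal (integral\<^sup>L M h)"
    and "ext_integral M f = ereal (integral\<^sup>L M h) \<longleftrightarrow> (AE t in M. f t = ereal (h t))"
proof -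
  let ?P = "\<lambda>t. e2ennreal (f t)" and ?N = "\<lambda>t. e2ennreal (- f t)"
  have [measurable]: "f \<in> borel_measurable M" "h \<in> borel_measurable M" using f h by auto
  have hfin: "(\<integral>\<^sup>+ t. ennreal (h t) \<partial>M) < \<infinity>" "(\<integral>\<^sup>+ t. ennreal (- h t) \<partial>M) < \<infinity>"
    using h by (auto simp: real_integrable_def top.not_eq_extremum)
  have Ple: "AE t in M. ?P t \<le> ennreal (h t)"
    using le by eventually_elim (metis e2ennreal_ereal e2ennreal_mono)
  have Nge: "AE t in M. ennreal (- h t) \<le> ?N t"
    using le by eventually_elim (metis e2ennreal_ereal e2ennreal_mono ereal_minus_le_minus uminus_ereal.simps(1))
  have PI: "integral\<^sup>N M ?P \<le> (\<integral>\<^sup>+ t. ennreal (h t) \<partial>M)" by (rule nn_integral_mono_AE[OF Ple])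
  have NI: "(\<integral>\<^sup>+ t. ennreal (- h t) \<partial>M) \<le> integral\<^sup>N M ?N" by (rule nn_integral_mono_AE[OF Nge])
  have hint: "ereal (integral\<^sup>L M h)
      = enn2ereal (\<integral>\<^sup>+ t. ennreal (h t) \<partial>M) - enn2ereal (\<integral>\<^sup>+ t. ennreal (- h t) \<partial>M)"
    using ext_integral_real[OF h] unfolding ext_integral_def by simp
  show "ext_integral M f \<le> ereal (integral\<^sup>L M h)"
    unfolding hint ext_integral_def using PI NI
    by (intro ereal_minus_mono) (auto simp: less_eq_ennreal.rep_eq)
  show "ext_integral M f = ereal (integral\<^sup>L M h) \<longleftrightarrow> (AE t in M. f t = ereal (h t))"
  proof
    assume "AE t in M. f t = ereal (h t)"
    then show "ext_integral M f = ereal (integral\<^sup>L M h)"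
      using ext_integral_cong_AE ext_integral_real[OF h] by metis
  next
    assume eq: "ext_integral M f = ereal (integral\<^sup>L M h)"
    have *: "p = p' \<and> n = n'" if "enn2ereal p - enn2ereal n = enn2ereal p' - enn2ereal n'"
      "p \<le> p'" "n' \<le> n" "p' < \<infinity>" "n' < \<infinity>" for p n p' n'
      using that by (cases p; cases n; cases p'; cases n') (auto simp: enn2ereal_ennreal)
    have e: "integral\<^sup>N M ?P = (\<integral>\<^sup>+ t. ennreal (h t) \<partial>M)" "(\<integral>\<^sup>+ t. ennreal (- h t) \<partial>M) = integral\<^sup>N M ?N"
      using *[OF eq[unfolded hint ext_integral_def] PI NI hfin] by auto
    have "AE t in M. ?P t = ennreal (h t)"
      using Ple e hfin by (intro nn_integral_eq_imp_AE_eq) auto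
    moreover have "AE t in M. ennreal (- h t) = ?N t"
      using Nge e hfin by (intro nn_integral_eq_imp_AE_eq) auto
    ultimately show "AE t in M. f t = ereal (h t)"
    proof eventually_elim
      case (elim t)
      show ?case
      proof (cases "0 \<le> h t")
        case True
        show ?thesis
        proof (cases "f t")
          case (real r)
          then show ?thesis using elim True by (cases "r \<ge> 0") (auto simp: ennreal_neg ennreal_eq_0_iff)
        qed (use elim True in \<open>auto simp: ennreal_neg\<close>)
      next
        case False
        show ?thesis
        proof (cases "f t")
          case (real r)
          then show ?thesis using elim False by (cases "r \<ge> 0") (auto simp: ennreal_neg ennreal_eq_0_iff)
        qed (use elim False in \<open>auto simp: ennreal_neg\<close>)
      qed
    qed
  qed
qed


section \<open>Sums of extended real inequalities\<close>

lemma sum_ereal_eq_sum_real_iff: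
  fixes W :: "'j \<Rightarrow> ereal" and w :: "'j \<Rightarrow> real"
  assumes "finite J" "\<And>j. j \<in> J \<Longrightarrow> ereal (w j) \<le> W j"
  shows "ereal (sum w J) \<le> sum W J \<and> (sum W J = ereal (sum w J) \<longleftrightarrow> (\<forall>j\<in>J. W j = ereal (w j)))"
  using assms
proof (induction J rule: finite_induct)
  case (insert j J)
  then have IH: "ereal (sum w J) \<le> sum W J" "sum W J = ereal (sum w J) \<longleftrightarrow> (\<forall>j\<in>J. W j = ereal (w j))"
    and "ereal (w j) \<le> W j" by auto
  then show ?case using insert.hyps
    by (cases "W j"; cases "sum W J") auto
qed auto

text \<open>
  The bounds exclude every indeterminate combination of infinities on the left, whose only possible
  infinite value is therefore \<open>-\<infinity>\<close>. If the left hand side is finite, all terms are, and a sum of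
  inequalities between real numbers is an equality only if every single one is.
\<close>

lemma ereal_gap_zero_iff:
  fixes W :: "'j \<Rightarrow> ereal" and w :: "'j \<Rightarrow> real"
  assumes C: "ereal c \<le> C" and I: "I \<le> ereal i" and V: "ereal v \<le> V"
    and W: "finite J" "\<And>j. j \<in> J \<Longrightarrow> ereal (w j) \<le> W j"
  shows "- C + I - sum W J - V \<le> ereal (- c + i - sum w J - v)"
    and "- C + I - sum W J - V = ereal (- c + i - sum w J - v) \<longleftrightarrow>
      C = ereal c \<and> I = ereal i \<and> (\<forall>j\<in>J. W j = ereal (w j)) \<and> V = ereal v"
proof -
  note S = sum_ereal_eq_sum_real_iff[of J w W, OF W]
  show "- C + I - sum W J - V \<le> ereal (- c + i - sum w J - v)"
    using C I V S[THEN conjunct1] by (cases C; cases I; cases V; cases "sum W J") auto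
  have "- C + I - sum W J - V = ereal (- c + i - sum w J - v) \<longleftrightarrow>
      C = ereal c \<and> I = ereal i \<and> sum W J = ereal (sum w J) \<and> V = ereal v"
    using C I V S[THEN conjunct1] by (cases C; cases I; cases V; cases "sum W J") auto
  then show "- C + I - sum W J - V = ereal (- c + i - sum w J - v) \<longleftrightarrow>
      C = ereal c \<and> I = ereal i \<and> (\<forall>j\<in>J. W j = ereal (w j)) \<and> V = ereal v"
    using S[THEN conjunct2] by simp
qed


section \<open>Integration by parts for jets and costates\<close>

text \<open>
  By this numbering of the index type, inner products of tuples become sums over \<open>i < \<kappa>\<close>, which can be
  telescoped and reversed.
\<close>

lemma bij_betw_pos: "bij_betw (pos :: 'k::{finite,linorder} \<Rightarrow> nat) UNIV {..<CARD('k)}"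
proof -
  have less: "pos i < pos j" if "i < j" for i j :: 'k
    unfolding pos_def using that by (intro psubset_card_mono) auto
  have inj: "inj (pos :: 'k \<Rightarrow> nat)"
    using less by (intro linorder_injI) (metis less_irrefl)
  have "pos i < CARD('k)" for i :: 'k
    unfolding pos_def by (intro psubset_card_mono) auto
  then have "range (pos :: 'k \<Rightarrow> nat) \<subseteq> {..<CARD('k)}" by auto
  then have "range (pos :: 'k \<Rightarrow> nat) = {..<CARD('k)}"
    using inj by (intro card_subset_eq) (auto simp: card_image)
  then show ?thesis using inj by (simp add: bij_betw_def)
qed

lemma inner_tuple:
  "(tuple f :: 'a::real_inner^'k::{finite,linorder}) \<bullet> tuple g = (\<Sum>i<CARD('k). f i \<bullet> g i)"
  unfolding inner_vec_def tuple_def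
  using sum.reindex_bij_betw[OF bij_betw_pos[where 'k = 'k], of "\<lambda>i. f i \<bullet> g i"] by simp

lemma ac_order_imp_ac_antiderivative:
  assumes "ac_order m x" "j < m"
  shows "ac_antiderivative 0 1 (tderiv j x) (tderiv (Suc j) x)"
proof (cases "Suc j = m")
  case True
  then show ?thesis using assms unfolding ac_order_def ac_antiderivative_def by (auto simp del: tderiv.simps)
next
  case False
  then have "Suc j < m" using assms(2) by simp
  then have "abs_continuous_on 0 1 (tderiv (Suc j) x)" 
    and "\<And>t. t \<in> {0..1} \<Longrightarrow> (tderiv j x has_vector_derivative tderiv (Suc j) x t) (at t within {0..1})"
    and "abs_continuous_on 0 1 (tderiv j x)"
    using assms unfolding ac_order_def by (auto simp del: tderiv.simps)
  then show ?thesis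
    unfolding ac_antiderivative_def
    by (auto simp del: tderiv.simps intro!: AE_I2 continuous_imp_integrable_real abs_continuous_on_imp_continuous_on)
qed

text \<open>
  The function \<open>\<eta> 0\<close> of a dual family is prescribed only on the unit interval, so it has to be treated
  there rather than as the constant function zero.
\<close>

lemma ac_antiderivative_eq_zero:
  assumes "\<And>t. t \<in> {0..1} \<Longrightarrow> f t = 0"
  shows "ac_antiderivative 0 1 f (tderiv (Suc 0) f)"
proof -
  have d: "(f has_vector_derivative 0) (at t within {0..1})" if "t \<in> {0..1}" for t
    using that assms by (intro has_vector_derivative_transform[OF _ _ has_vector_derivative_const]) auto
  then have z: "tderiv (Suc 0) f t = 0" if "t \<in> {0..1}" for t
    using that vector_derivative_within_closed_interval[of 0 1 t f 0] by simp
  have "integrable (lebesgue_on {0..1}) (tderiv (Suc 0) f)"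
    using z by (subst Bochner_Integration.integrable_cong[where g = "\<lambda>t. 0"]) (auto simp del: tderiv.simps)
  moreover have "abs_continuous_on 0 1 f"
    by (rule abs_continuous_on_combine[of 0 1 "\<lambda>t. 0::real" "\<lambda>t. 0::real" 1])
       (auto simp: assms abs_continuous_on_def)
  ultimately show ?thesis
    using d z unfolding ac_antiderivative_def by (auto simp del: tderiv.simps intro!: AE_I2)
qed

lemma dual_family_ac_antiderivative:
  assumes "dual_family \<kappa> xs \<eta>" "j < \<kappa>"
  shows "ac_antiderivative 0 1 (\<eta> j) (tderiv 1 (\<eta> j))"
proof (cases "j = 0")
  case True
  then show ?thesis using assms ac_antiderivative_eq_zero[of "\<eta> 0"] by (simp add: dual_family_def)
next
  case False
  then have "ac_order 1 (\<eta> j)" using assms by (auto simp: dual_family_def)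
  from ac_order_imp_ac_antiderivative[OF this, of 0] show ?thesis by simp
qed

text \<open>
  The multiplier paired with the derivative of order \<open>i\<close> of the trajectory. The end tuple collects the
  values at time 1, and the initial condition speaks of the values at time 0.
\<close>

definition costate ::
    "nat \<Rightarrow> (real \<Rightarrow> 'a::euclidean_space) \<Rightarrow> (nat \<Rightarrow> real \<Rightarrow> 'a) \<Rightarrow> nat \<Rightarrow> real \<Rightarrow> 'a" where
  "costate \<kappa> xs \<eta> i t = (-1) ^ (\<kappa> - i) *\<^sub>R tderiv (\<kappa> - 1 - i) xs t + \<eta> (\<kappa> - 1 - i) t"

definition costate_deriv ::
    "nat \<Rightarrow> (real \<Rightarrow> 'a::euclidean_space) \<Rightarrow> (nat \<Rightarrow> real \<Rightarrow> 'a) \<Rightarrow> nat \<Rightarrow> real \<Rightarrow> 'a" where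
  "costate_deriv \<kappa> xs \<eta> i t = (-1) ^ (\<kappa> - i) *\<^sub>R tderiv (\<kappa> - i) xs t + tderiv 1 (\<eta> (\<kappa> - 1 - i)) t"

lemma costate_ac_antiderivative:
  assumes "dual_family \<kappa> xs \<eta>" "i < \<kappa>"
  shows "ac_antiderivative 0 1 (costate \<kappa> xs \<eta> i) (costate_deriv \<kappa> xs \<eta> i)"
proof -
  have "Suc (\<kappa> - 1 - i) = \<kappa> - i" using assms(2) by simp
  then have "ac_antiderivative 0 1 (tderiv (\<kappa> - 1 - i) xs) (tderiv (\<kappa> - i) xs)"
    using ac_order_imp_ac_antiderivative[of \<kappa> xs "\<kappa> - 1 - i"] assms
    by (auto simp: dual_family_def simp del: tderiv.simps)
  moreover have "ac_antiderivative 0 1 (\<eta> (\<kappa> - 1 - i)) (tderiv 1 (\<eta> (\<kappa> - 1 - i)))"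
    using assms by (intro dual_family_ac_antiderivative) auto
  ultimately show ?thesis
    unfolding costate_def[abs_def] costate_deriv_def[abs_def]
    by (intro ac_antiderivative_add ac_antiderivative_scaleR)
qed

text \<open>
  Here \<open>(-1)\<^sup>\<kappa>\<^sup>-\<^sup>i\<close> changes sign from \<open>i\<close> to \<open>i + 1\<close>, so that the terms with derivatives of \<open>xs\<close> cancel in
  neighbouring summands, leaving \<open>(-1)\<^sup>\<kappa> \<langle>x, xs\<^sup>(\<^sup>\<kappa>\<^sup>)\<rangle>\<close> and \<open>-\<langle>x\<^sup>(\<^sup>\<kappa>\<^sup>), xs\<rangle>\<close>; the terms with \<open>\<eta>\<close> regroup
  into the components of the adjoint tuple, as \<open>\<eta>\<^sub>\<kappa>\<^sub>-\<^sub>i\<close> arises from the summand \<open>i - 1\<close>.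
\<close>

lemma inner_jet_adj_tuple:
  fixes x xs :: "real \<Rightarrow> real^'n" and \<eta> :: "nat \<Rightarrow> real \<Rightarrow> real^'n"
  defines "\<kappa> \<equiv> CARD('k::{finite,linorder})"
  assumes \<eta>0: "\<eta> 0 t = 0"
  shows "jet x t \<bullet> (adj_tuple xs \<eta> t :: (real^'n)^'k::{finite,linorder}) - tderiv \<kappa> x t \<bullet> xs t
    = (\<Sum>i<\<kappa>. tderiv i x t \<bullet> costate_deriv \<kappa> xs \<eta> i t + tderiv (Suc i) x t \<bullet> costate \<kappa> xs \<eta> i t)"
proof -
  \<comment> \<open>\<open>G (Suc i)\<close> is the second half of the summand \<open>i\<close>, and, for \<open>i > 0\<close>, \<open>H i\<close> pairs
      the component \<open>i\<close> of the jet with that of the adjoint tuple.\<close>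
  define G where "G i = tderiv i x t \<bullet> (\<eta> (\<kappa> - i) t - (-1) ^ (\<kappa> - i) *\<^sub>R tderiv (\<kappa> - i) xs t)" for i
  define H where "H i = tderiv i x t \<bullet> (\<eta> (\<kappa> - i) t + tderiv 1 (\<eta> (\<kappa> - 1 - i)) t)" for i
  have "\<kappa> > 0" unfolding \<kappa>_def by simp
  then have split: "{..<\<kappa>} = insert 0 {1..<\<kappa>}" by auto
  have step: "tderiv i x t \<bullet> costate_deriv \<kappa> xs \<eta> i t + tderiv (Suc i) x t \<bullet> costate \<kappa> xs \<eta> i t
      = (G (Suc i) - G i) + H i" if "i < \<kappa>" for i
  proof -
    have "\<kappa> - i = Suc (\<kappa> - Suc i)" using that by simp
    then have sign: "(-1::real) ^ (\<kappa> - i) = - ((-1) ^ (\<kappa> - Suc i))" by simp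
    have pred: "\<kappa> - 1 - i = \<kappa> - Suc i" by simp
    show ?thesis
      unfolding G_def H_def costate_def costate_deriv_def pred sign
      by (simp only: inner_add_right inner_diff_right inner_scaleR_right algebra_simps minus_mult_left[symmetric])
  qed
  have "(\<Sum>i<\<kappa>. tderiv i x t \<bullet> costate_deriv \<kappa> xs \<eta> i t + tderiv (Suc i) x t \<bullet> costate \<kappa> xs \<eta> i t)
      = (\<Sum>i<\<kappa>. (G (Suc i) - G i) + H i)"
    using step by (intro sum.cong) auto
  also have "\<dots> = G \<kappa> - G 0 + (\<Sum>i<\<kappa>. H i)"
    by (simp add: sum.distrib sum_lessThan_telescope)
  also have "G \<kappa> = - (tderiv \<kappa> x t \<bullet> xs t)"
    unfolding G_def using \<eta>0 by simp
  also have "- (tderiv \<kappa> x t \<bullet> xs t) - G 0 + (\<Sum>i<\<kappa>. H i)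
      = (H 0 - G 0 + (\<Sum>i\<in>{1..<\<kappa>}. H i)) - tderiv \<kappa> x t \<bullet> xs t"
    by (simp add: split)
  also have "H 0 - G 0 = tderiv 0 x t \<bullet> ((-1) ^ \<kappa> *\<^sub>R tderiv \<kappa> xs t + tderiv 1 (\<eta> (\<kappa> - 1 - 0)) t)"
    unfolding G_def H_def by (simp del: tderiv.simps One_nat_def add: inner_add_right inner_diff_right)
  also have "\<dots> + (\<Sum>i\<in>{1..<\<kappa>}. H i) = jet x t \<bullet> (adj_tuple xs \<eta> t :: (real^'n)^'k::{finite,linorder})"
    unfolding jet_def adj_tuple_def inner_tuple \<kappa>_def[symmetric] split
    by (simp del: tderiv.simps One_nat_def add: H_def)
  finally show ?thesis by simp
qed

text \<open>
  Integration by parts. The integrand is the Lagrangian that \<open>M\<close> minimizes over the graph,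
  evaluated along the trajectory.
\<close>

lemma integral_jet_adj_tuple:
  fixes x xs :: "real \<Rightarrow> real^'n" and \<eta> :: "nat \<Rightarrow> real \<Rightarrow> real^'n"
  defines "\<kappa> \<equiv> CARD('k::{finite,linorder})"
  defines "h \<equiv> \<lambda>t. jet x t \<bullet> (adj_tuple xs \<eta> t :: (real^'n)^'k::{finite,linorder}) - tderiv \<kappa> x t \<bullet> xs t"
  assumes x: "ac_order \<kappa> x" and dual: "dual_family \<kappa> xs \<eta>"
  shows "integrable (lebesgue_on {0..1}) h"
    and "integral\<^sup>L (lebesgue_on {0..1}) h
      = jet x 1 \<bullet> (end_tuple xs \<eta> :: (real^'n)^'k::{finite,linorder}) - (\<Sum>i<\<kappa>. tderiv i x 0 \<bullet> costate \<kappa> xs \<eta> i 0)"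
proof -
  let ?d = "\<lambda>t. \<Sum>i<\<kappa>. tderiv i x t \<bullet> costate_deriv \<kappa> xs \<eta> i t + tderiv (Suc i) x t \<bullet> costate \<kappa> xs \<eta> i t"
  have ad: "ac_antiderivative 0 1 (\<lambda>t. \<Sum>i<\<kappa>. tderiv i x t \<bullet> costate \<kappa> xs \<eta> i t) ?d"
    using x dual
    by (intro ac_antiderivative_sum ac_antiderivative_inner costate_ac_antiderivative
        ac_order_imp_ac_antiderivative) auto
  have hd: "h t = ?d t" if "t \<in> {0..1}" for t
  proof -
    have "\<eta> 0 t = 0" using dual that by (simp add: dual_family_def)
    then show ?thesis unfolding h_def \<kappa>_def by (rule inner_jet_adj_tuple)
  qed
  show "integrable (lebesgue_on {0..1}) h"
    using ad hd unfolding ac_antiderivative_def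
    by (subst Bochner_Integration.integrable_cong[where g = ?d]) auto
  have "integral\<^sup>L (lebesgue_on {0..1}) h = integral\<^sup>L (lebesgue_on {0..1}) ?d"
    using hd by (intro Bochner_Integration.integral_cong) auto
  also have "\<dots> = (\<Sum>i<\<kappa>. tderiv i x 1 \<bullet> costate \<kappa> xs \<eta> i 1) - (\<Sum>i<\<kappa>. tderiv i x 0 \<bullet> costate \<kappa> xs \<eta> i 0)"
    using lebesgue_integral_ac_antiderivative[OF _ ad] by simp
  also have "(\<Sum>i<\<kappa>. tderiv i x 1 \<bullet> costate \<kappa> xs \<eta> i 1) = jet x 1 \<bullet> (end_tuple xs \<eta> :: (real^'n)^'k::{finite,linorder})"
    unfolding jet_def end_tuple_def inner_tuple costate_def \<kappa>_def ..
  finally show "integral\<^sup>L (lebesgue_on {0..1}) h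
      = jet x 1 \<bullet> (end_tuple xs \<eta> :: (real^'n)^'k::{finite,linorder}) - (\<Sum>i<\<kappa>. tderiv i x 0 \<bullet> costate \<kappa> xs \<eta> i 0)" .
qed

text \<open>
  Renumbering by \<open>j = \<kappa> - 1 - i\<close> brings the initial boundary terms into the form of the arguments of the
  support functions; the case \<open>j = 0\<close> is the separate term with \<open>xs 0\<close>.
\<close>

lemma sum_costate_initial:
  fixes x xs :: "real \<Rightarrow> 'a::euclidean_space"
  assumes "\<kappa> > 0" and \<eta>0: "\<eta> 0 0 = 0"
  shows "(\<Sum>i<\<kappa>. tderiv i x 0 \<bullet> costate \<kappa> xs \<eta> i 0)
    = - (\<Sum>j\<in>{1..<\<kappa>}. tderiv (\<kappa> - j - 1) x 0 \<bullet> ((-1) ^ j *\<^sub>R tderiv j xs 0 - \<eta> j 0))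
      - tderiv (\<kappa> - 1) x 0 \<bullet> xs 0"
proof -
  have "(\<Sum>i<\<kappa>. tderiv i x 0 \<bullet> costate \<kappa> xs \<eta> i 0)
      = (\<Sum>j<\<kappa>. tderiv (\<kappa> - Suc j) x 0 \<bullet> costate \<kappa> xs \<eta> (\<kappa> - Suc j) 0)"
    by (rule sum.nat_diff_reindex[symmetric])
  also have "\<dots> = (\<Sum>j<\<kappa>. - (tderiv (\<kappa> - j - 1) x 0 \<bullet> ((-1) ^ j *\<^sub>R tderiv j xs 0 - \<eta> j 0)))"
  proof (rule sum.cong)
    fix j assume "j \<in> {..<\<kappa>}"
    then have "\<kappa> - (\<kappa> - Suc j) = Suc j" "\<kappa> - 1 - (\<kappa> - Suc j) = j" "\<kappa> - j - 1 = \<kappa> - Suc j" by auto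
    then show "tderiv (\<kappa> - Suc j) x 0 \<bullet> costate \<kappa> xs \<eta> (\<kappa> - Suc j) 0
        = - (tderiv (\<kappa> - j - 1) x 0 \<bullet> ((-1) ^ j *\<^sub>R tderiv j xs 0 - \<eta> j 0))"
      unfolding costate_def by (simp del: tderiv.simps add: inner_add_right inner_diff_right)
  qed simp
  also have "\<dots> = - (\<Sum>j\<in>{1..<\<kappa>}. tderiv (\<kappa> - j - 1) x 0 \<bullet> ((-1) ^ j *\<^sub>R tderiv j xs 0 - \<eta> j 0))
      - tderiv (\<kappa> - 1) x 0 \<bullet> xs 0"
  proof -
    have "{..<\<kappa>} = insert 0 {1..<\<kappa>}" using assms(1) by auto
    then show ?thesis using \<eta>0 by (simp add: sum_negf)
  qed
  finally show ?thesis .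
qed


section \<open>Weak duality and its equality case\<close>

text \<open>
  Feasibility puts \<open>(jet x t, x\<^sup>(\<^sup>\<kappa>\<^sup>)(t))\<close> into the graph over which \<open>M\<close> is an infimum, for almost all \<open>t\<close>.
\<close>

lemma dual_integrand_compared:
  fixes F :: "(real^'n)^'k::{finite,linorder} \<Rightarrow> real \<Rightarrow> (real^'n) set"
    and x xs :: "real \<Rightarrow> real^'n" and \<eta> :: "nat \<Rightarrow> real \<Rightarrow> real^'n"
  defines "h \<equiv> \<lambda>t. jet x t \<bullet> (adj_tuple xs \<eta> t :: (real^'n)^'k::{finite,linorder}) - tderiv CARD('k) x t \<bullet> xs t"
  assumes x: "feasible F Q x"
  shows "AE t in lebesgue_on {0..1}. dual_integrand F xs \<eta> t \<le> ereal (h t)"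
    and "(AE t in lebesgue_on {0..1}. dual_integrand F xs \<eta> t = ereal (h t)) \<longleftrightarrow> adjoint_inclusion F x xs \<eta>"
proof -
  have F: "AE t in lebesgue_on {0..1}. tderiv CARD('k) x t \<in> F (jet x t) t"
    using x by (simp add: feasible_def)
  show "AE t in lebesgue_on {0..1}. dual_integrand F xs \<eta> t \<le> ereal (h t)"
    using F unfolding dual_integrand_def h_def by eventually_elim (rule M_fun_le)
  have "AE t in lebesgue_on {0..1}. dual_integrand F xs \<eta> t = ereal (h t) \<longleftrightarrow>
      adj_tuple xs \<eta> t \<in> lam (\<lambda>z. F z t) (xs t) (jet x t, tderiv CARD('k) x t)"
    using F unfolding dual_integrand_def h_def by eventually_elim (rule M_fun_attained_iff)
  then show "(AE t in lebesgue_on {0..1}. dual_integrand F xs \<eta> t = ereal (h t)) \<longleftrightarrow> adjoint_inclusion F x xs \<eta>"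
    unfolding adjoint_inclusion_def by (rule eventually_subst)
qed

text \<open>
  By the adjoint inclusion the dual integrand agrees almost everywhere with a real integrable function.
\<close>

lemma adjoint_inclusion_imp_dual_admissible:
  fixes F :: "(real^'n)^'k::{finite,linorder} \<Rightarrow> real \<Rightarrow> (real^'n) set"
  assumes x: "feasible F Q x" and dual: "dual_family CARD('k) xs \<eta>" and "adjoint_inclusion F x xs \<eta>"
  shows "dual_admissible F xs \<eta>"
proof -
  let ?h = "\<lambda>t. jet x t \<bullet> (adj_tuple xs \<eta> t :: (real^'n)^'k::{finite,linorder}) - tderiv CARD('k) x t \<bullet> xs t"
  let ?M = "lebesgue_on {0..1::real}"
  interpret complete_measure ?M by (rule complete_measure_lebesgue_on) simp
  have h: "integrable ?M ?h"
    using x dual by (intro integral_jet_adj_tuple(1)) (auto simp: feasible_def)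
  have eq: "AE t in ?M. dual_integrand F xs \<eta> t = ereal (?h t)"
    using dual_integrand_compared(2)[OF x] assms(3) by blast
  have "(\<lambda>t. ereal (?h t)) \<in> borel_measurable ?M" using h by measurable
  then have "dual_integrand F xs \<eta> \<in> borel_measurable ?M" using eq by (rule measurable_AE_cong)
  moreover have "(\<integral>\<^sup>+ t. e2ennreal (dual_integrand F xs \<eta> t) \<partial>?M) = (\<integral>\<^sup>+ t. ennreal (?h t) \<partial>?M)"
    by (intro nn_integral_cong_AE eventually_mono[OF eq]) simp
  moreover have "(\<integral>\<^sup>+ t. ennreal (?h t) \<partial>?M) < \<infinity>"
    using h by (auto simp: real_integrable_def top.not_eq_extremum)
  ultimately show ?thesis
    using dual unfolding dual_admissible_def ext_integral_exists_def by simp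
qed

text \<open>
  The gap between the two objectives is a sum of nonnegative gaps, one for the conjugate, one for the
  integral of \<open>M\<close> and one for each support function. It closes if and only if all of them do.
\<close>

theorem weak_duality:
  fixes \<phi> :: "(real^'n)^'k::{finite,linorder} \<Rightarrow> real"
  assumes x: "feasible F Q x" and adm: "dual_admissible F xs \<eta>"
  shows "dual_objective \<phi> F Q xs \<eta> \<le> ereal (\<phi> (jet x 1))"
    and "dual_objective \<phi> F Q xs \<eta> = ereal (\<phi> (jet x 1)) \<longleftrightarrow>
      adjoint_inclusion F x xs \<eta> \<and> initial_condition CARD('k) Q x xs \<eta> \<and> transversality \<phi> x xs \<eta>"
proof -
  let ?\<kappa> = "CARD('k)" and ?M = "lebesgue_on {0..1::real}"
  let ?h = "\<lambda>t. jet x t \<bullet> (adj_tuple xs \<eta> t :: (real^'n)^'k::{finite,linorder}) - tderiv CARD('k) x t \<bullet> xs t"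
  let ?E = "end_tuple xs \<eta> :: (real^'n)^'k::{finite,linorder}"
  \<comment> \<open>\<open>c\<close>, \<open>i\<close>, \<open>w\<close>, \<open>v\<close> are the terms of the dual objective with the infima and suprema
      in them evaluated at \<open>x\<close>.\<close>
  define p where "p j = (-1) ^ j *\<^sub>R tderiv j xs 0 - \<eta> j 0" for j
  define w where "w j = tderiv (?\<kappa> - j - 1) x 0 \<bullet> p j" for j
  define c where "c = jet x 1 \<bullet> ?E - \<phi> (jet x 1)"
  define v where "v = tderiv (?\<kappa> - 1) x 0 \<bullet> xs 0"
  define i where "i = integral\<^sup>L ?M ?h"
  have dual: "dual_family ?\<kappa> xs \<eta>" and meas: "dual_integrand F xs \<eta> \<in> borel_measurable ?M"
    using adm by (auto simp: dual_admissible_def ext_integral_exists_def)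
  have ac: "ac_order ?\<kappa> x" and xQ: "\<And>j. j < ?\<kappa> \<Longrightarrow> tderiv j x 0 \<in> Q j"
    using x by (auto simp: feasible_def)
  have k0: "?\<kappa> > 0" by simp
  have \<eta>0: "\<eta> 0 0 = 0" using dual by (simp add: dual_family_def)
  have h: "integrable ?M ?h" by (rule integral_jet_adj_tuple(1)[OF ac dual])
  have phi: "\<phi> (jet x 1) = - c + i - sum w {1..<?\<kappa>} - v"
    unfolding c_def i_def v_def w_def p_def integral_jet_adj_tuple(2)[OF ac dual]
      sum_costate_initial[where \<kappa> = ?\<kappa> and \<eta> = \<eta>, OF k0 \<eta>0] by simp
  have objective: "dual_objective \<phi> F Q xs \<eta> = - conjugate \<phi> ?E + ext_integral ?M (dual_integrand F xs \<eta>)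
      - (\<Sum>j\<in>{1..<?\<kappa>}. supp_fun (Q (?\<kappa> - j - 1)) (p j)) - supp_fun (Q (?\<kappa> - 1)) (xs 0)"
    unfolding dual_objective_def p_def ..
  have C: "ereal c \<le> conjugate \<phi> ?E" unfolding c_def by (rule conjugate_ge)
  have I: "ext_integral ?M (dual_integrand F xs \<eta>) \<le> ereal i"
    unfolding i_def by (rule ext_integral_le_integral(1)[OF h dual_integrand_compared(1)[OF x] meas])
  have V: "ereal v \<le> supp_fun (Q (?\<kappa> - 1)) (xs 0)"
    unfolding v_def by (intro supp_fun_ge xQ) simp
  have W: "ereal (w j) \<le> supp_fun (Q (?\<kappa> - j - 1)) (p j)" if "j \<in> {1..<?\<kappa>}" for j
    unfolding w_def using that by (intro supp_fun_ge xQ) auto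
  note gap = ereal_gap_zero_iff[where w = w, OF C I V finite_atLeastLessThan W]
  show "dual_objective \<phi> F Q xs \<eta> \<le> ereal (\<phi> (jet x 1))"
    unfolding objective phi by (rule gap(1))
  have "dual_objective \<phi> F Q xs \<eta> = ereal (\<phi> (jet x 1)) \<longleftrightarrow>
      conjugate \<phi> ?E = ereal c \<and> ext_integral ?M (dual_integrand F xs \<eta>) = ereal i \<and>
      (\<forall>j\<in>{1..<?\<kappa>}. supp_fun (Q (?\<kappa> - j - 1)) (p j) = ereal (w j)) \<and>
      supp_fun (Q (?\<kappa> - 1)) (xs 0) = ereal v"
    unfolding objective phi by (rule gap(2))
  moreover have "conjugate \<phi> ?E = ereal c \<longleftrightarrow> transversality \<phi> x xs \<eta>"
    unfolding c_def transversality_def by (rule conjugate_attained_iff)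
  moreover have "ext_integral ?M (dual_integrand F xs \<eta>) = ereal i \<longleftrightarrow> adjoint_inclusion F x xs \<eta>"
    unfolding i_def ext_integral_le_integral(2)[OF h dual_integrand_compared(1)[OF x] meas]
    by (rule dual_integrand_compared(2)[OF x])
  moreover have "supp_fun (Q (?\<kappa> - 1)) (xs 0) = ereal v \<longleftrightarrow>
      - xs 0 \<in> dual_cone (Q (?\<kappa> - 1)) (tderiv (?\<kappa> - 1) x 0)"
    unfolding v_def by (intro supp_fun_attained_iff xQ) simp
  moreover have "supp_fun (Q (?\<kappa> - j - 1)) (p j) = ereal (w j) \<longleftrightarrow>
      (-1) ^ (j + 1) *\<^sub>R tderiv j xs 0 + \<eta> j 0 \<in> dual_cone (Q (?\<kappa> - j - 1)) (tderiv (?\<kappa> - j - 1) x 0)"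
    if "j \<in> {1..<?\<kappa>}" for j
  proof -
    have "tderiv (?\<kappa> - j - 1) x 0 \<in> Q (?\<kappa> - j - 1)" using that by (intro xQ) auto
    from supp_fun_attained_iff[OF this, of "p j"] show ?thesis
      by (simp add: w_def p_def del: tderiv.simps)
  qed
  ultimately show "dual_objective \<phi> F Q xs \<eta> = ereal (\<phi> (jet x 1)) \<longleftrightarrow>
      adjoint_inclusion F x xs \<eta> \<and> initial_condition CARD('k) Q x xs \<eta> \<and> transversality \<phi> x xs \<eta>"
    unfolding initial_condition_def by blast
qed

theorem theorem4p1:
  fixes \<phi> :: "(real^'n)^'k::{finite,linorder} \<Rightarrow> real"
    and F :: "(real^'n)^'k::{finite,linorder} \<Rightarrow> real \<Rightarrow> (real^'n) set"
    and Q :: "nat \<Rightarrow> (real^'n) set"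
    and x :: "real \<Rightarrow> real^'n"
  assumes "continuous_on UNIV \<phi>" and "convex_on UNIV \<phi>"
    and "\<And>t. t \<in> {0..1} \<Longrightarrow> convex_map (\<lambda>z. F z t)"
    and "\<And>j. j < CARD('k) \<Longrightarrow> convex (Q j)"
    and "primal_optimal \<phi> F Q x"
    and "\<exists>xs \<eta>. dual_family CARD('k) xs \<eta> \<and>
           adjoint_inclusion F x xs \<eta> \<and>
           initial_condition CARD('k) Q x xs \<eta> \<and>
           transversality \<phi> x xs \<eta> \<and>
           maximum_condition F x xs"
  shows "(\<forall>xs \<eta>. dual_family CARD('k) xs \<eta> \<longrightarrow>
           (dual_optimal \<phi> F Q xs \<eta> \<longleftrightarrow>
              adjoint_inclusion F x xs \<eta> \<and>
              initial_condition CARD('k) Q x xs \<eta> \<and>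
              transversality \<phi> x xs \<eta>))
         \<and> primal_value \<phi> F Q = dual_value \<phi> F Q"
proof -
  let ?conds = "\<lambda>xs \<eta>. adjoint_inclusion F x xs \<eta> \<and> initial_condition CARD('k) Q x xs \<eta> \<and> transversality \<phi> x xs \<eta>"
  have x: "feasible F Q x" and min: "\<And>y. feasible F Q y \<Longrightarrow> \<phi> (jet x 1) \<le> \<phi> (jet y 1)"
    using assms(5) by (auto simp: primal_optimal_def)
  have attains: "dual_admissible F xs \<eta> \<and> dual_objective \<phi> F Q xs \<eta> = ereal (\<phi> (jet x 1))"
    if "dual_family CARD('k) xs \<eta>" "?conds xs \<eta>" for xs \<eta>
    using that adjoint_inclusion_imp_dual_admissible[OF x] weak_duality(2)[OF x] by blast
  obtain ys \<theta> where ys: "dual_admissible F ys \<theta>" "dual_objective \<phi> F Q ys \<theta> = ereal (\<phi> (jet x 1))"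
    using assms(6) attains by blast
  have optimal_iff: "dual_optimal \<phi> F Q xs \<eta> \<longleftrightarrow> ?conds xs \<eta>" if dual: "dual_family CARD('k) xs \<eta>" for xs \<eta>
  proof
    assume opt: "dual_optimal \<phi> F Q xs \<eta>"
    then have adm: "dual_admissible F xs \<eta>" by (simp add: dual_optimal_def)
    have "ereal (\<phi> (jet x 1)) \<le> dual_objective \<phi> F Q xs \<eta>"
      using opt ys unfolding dual_optimal_def by metis
    then have "dual_objective \<phi> F Q xs \<eta> = ereal (\<phi> (jet x 1))"
      using weak_duality(1)[OF x adm] by (rule antisym[rotated])
    then show "?conds xs \<eta>" using weak_duality(2)[OF x adm] by blast
  next
    assume "?conds xs \<eta>"
    then show "dual_optimal \<phi> F Q xs \<eta>"
      using attains[OF dual] weak_duality(1)[OF x] unfolding dual_optimal_def by simp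
  qed
  have "primal_value \<phi> F Q = ereal (\<phi> (jet x 1))"
    unfolding primal_value_def using x min by (intro antisym INF_lower INF_greatest) auto
  moreover have "dual_value \<phi> F Q = ereal (\<phi> (jet x 1))"
  proof (rule antisym)
    show "dual_value \<phi> F Q \<le> ereal (\<phi> (jet x 1))"
      unfolding dual_value_def using weak_duality(1)[OF x] by (intro SUP_least) auto
    show "ereal (\<phi> (jet x 1)) \<le> dual_value \<phi> F Q"
      unfolding dual_value_def using ys by (intro SUP_upper2[of "(ys, \<theta>)"]) auto
  qed
  ultimately show ?thesis using optimal_iff by simp
qed

end
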